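(* For all $n\in\mathbb{N}$, \[ \dim(\mathbf{WQSym}_n) = \#\mathfrak{F}_n, \qquad \dim(\operatorname{Prim}_n) = \#\mathfrak{T}_n, \qquad \dim(\operatorname{TPrim}_n) = \#\mathfrak{P}_n. \]
   Context: Packed words: a word over $\mathbb{N}_{>0}$ is packed if every letter from $1$ to its maximum appears at least once ($\epsilon$ is packed, $\max(\epsilon)=0$); $\mathbf{PW}_n$ is the set of packed words of length $n$. For a word $w$ whose distinct letters are $b_1<\dots<b_r$, $\mathrm{pack}(w)$ is the image of $w$ under $b_i\mapsto i$. $\mathbf{WQSym}_n$ is the vector space over a field $K$ with basis $(\mathbb{R}_w)_{w\in\mathbf{PW}_n}$, and $\mathbf{WQSym}_+=\bigoplus_{n\ge1}\mathbf{WQSym}_n$. Half-coproducts: for $u=u_1\cdots u_n\in\mathbf{PW}_n$, $n\ge1$, $\Delta_\prec(\mathbb{R}_u)=\sum \mathbb{R}_{\mathrm{pack}(u_1\cdots u_i)}\otimes\mathbb{R}_{\mathrm{pack}(u_{i+1}\cdots u_n)}$, summed over $1\le i\le n-1$ such that $\{u_1,\dots,u_i\}\cap\{u_{i+1},\dots,u_n\}=\emptyset$ and all occurrences of $\max(u)$ lie in positions $\le i$; $\Delta_\succ(\mathbb{R}_u)$ is the same sum but over those $i$ such that the letter sets are disjoint and all occurrences of $\max(u)$ lie in positions $>i$. (Example: $\Delta_\prec(\mathbb{R}_{2125334})=\mathbb{R}_{2123}\otimes\mathbb{R}_{112}+\mathbb{R}_{212433}\otimes\mathbb{R}_1$, $\Delta_\succ(\mathbb{R}_{2125334})=\mathbb{R}_{212}\otimes\mathbb{R}_{3112}$.)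 Extend linearly. Let $\tilde\Delta=\Delta_\prec+\Delta_\succ$, $\operatorname{Prim}=\operatorname{Ker}\tilde\Delta\subseteq\mathbf{WQSym}_+$, $\operatorname{TPrim}=\operatorname{Ker}\Delta_\prec\cap\operatorname{Ker}\Delta_\succ$, and $\operatorname{Prim}_n=\operatorname{Prim}\cap\mathbf{WQSym}_n$, $\operatorname{TPrim}_n=\operatorname{TPrim}\cap\mathbf{WQSym}_n$. Packed trees: a labeled biplane tree is $t=\operatorname{Node}(I,f_\ell,f_r)$ where the label $I=[i_1,\dots,i_p]$ is a strictly increasing non-empty list of positive integers and $f_\ell=[\ell_1,\dots,\ell_g]$, $f_r=[r_1,\dots,r_d]$ are (possibly empty) ordered lists of labeled biplane trees (left and right forests). The weight is $\omega(t)=p+\sum_{a}\omega(\ell_a)+\sum_b\omega(r_b)$, and the right-weight is $\omega_r(t)=p+\sum_b\omega(r_b)$; the weight of a forest is the sum of weights of its trees. $t$ is a packed tree if: (i) when $d=0$, $i_k=k$ for all $k$; when $d\ge1$, $1\le i_1\le\omega(r_1)$ and $1\le\omega_r(t)+1-i_p\le\omega(r_d)$; and (ii) all trees of $f_\ell$ and $f_r$ are packed trees. A packed forest is a finite (possibly empty) list of packed trees. $\mathfrak{F}_n$ is the set of packed forests of weight $n$, $\mathfrak{T}_n$ the set of packed trees of weight $n$, and $\mathfrak{P}_n$ the set of packed trees of weight $n$ whose left forest is empty. *)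

theory Defs
  imports Complex_Main "HOL-Library.Poly_Mapping"
begin

section \<open>Packed words\<close>

text \<open>Words over the positive integers are lists of naturals.\<close>

definition max_letter :: "nat list \<Rightarrow> nat" where
  "max_letter w = Max (insert 0 (set w))"

definition packed :: "nat list \<Rightarrow> bool" where
  "packed w \<longleftrightarrow> set w = {1..max_letter w}"

definition PW :: "nat \<Rightarrow> nat list set" where
  "PW n = {w. packed w \<and> length w = n}"

text \<open>The letter \<open>b\<^sub>i\<close> is sent to its rank \<open>i\<close> among the distinct letters of the word.\<close>

definition pack :: "nat list \<Rightarrow> nat list" where
  "pack w = map (\<lambda>x. card {y \<in> set w. y \<le> x}) w"

section \<open>Free vector spaces\<close>

text \<open>
  The free vector space over a field \<open>'k\<close> on a set of generators of type \<open>'a\<close> is modelled by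
  finitely supported functions \<open>'a \<Rightarrow>\<^sub>0 'k\<close>; the basis vector of \<open>a\<close> is \<open>Poly_Mapping.single a 1\<close>.
  The tensor product of the free spaces on \<open>'a\<close> and on \<open>'b\<close> is the free space on \<open>'a \<times> 'b\<close>.
\<close>

definition scale :: "'k::field \<Rightarrow> ('a \<Rightarrow>\<^sub>0 'k) \<Rightarrow> ('a \<Rightarrow>\<^sub>0 'k)" where
  "scale c f = Poly_Mapping.map ((*) c) f"

lemma lookup_scale [simp]: "Poly_Mapping.lookup (scale c f) a = c * Poly_Mapping.lookup f a"
  by (simp add: scale_def map.rep_eq when_def)

lemma vector_space_scale: "vector_space scale"
  unfolding vector_space_def by (auto intro!: poly_mapping_eqI simp: lookup_add algebra_simps)

definition linear_extension :: "('a \<Rightarrow> ('b \<Rightarrow>\<^sub>0 'k::field)) \<Rightarrow> ('a \<Rightarrow>\<^sub>0 'k) \<Rightarrow> ('b \<Rightarrow>\<^sub>0 'k)" where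
  "linear_extension \<phi> f = (\<Sum>a\<in>Poly_Mapping.keys f. scale (Poly_Mapping.lookup f a) (\<phi> a))"

section \<open>The space WQSym and its half-coproducts\<close>

text \<open>The basis element \<open>R\<^sub>w\<close> is \<open>Poly_Mapping.single w 1\<close>.\<close>

definition R_tensor :: "nat list \<Rightarrow> nat list \<Rightarrow> (nat list \<times> nat list \<Rightarrow>\<^sub>0 'k::field)" where
  "R_tensor u v = Poly_Mapping.single (u, v) 1"

definition WQSym :: "nat \<Rightarrow> (nat list \<Rightarrow>\<^sub>0 'k::field) set" where
  "WQSym n = {f. Poly_Mapping.keys f \<subseteq> PW n}"

definition WQSym_plus :: "(nat list \<Rightarrow>\<^sub>0 'k::field) set" where
  "WQSym_plus = {f. Poly_Mapping.keys f \<subseteq> (\<Union>n\<in>{1..}. PW n)}"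

text \<open>A cut \<open>i\<close> splits \<open>u\<close> into \<open>take i u\<close> and \<open>drop i u\<close>.\<close>

definition cuts :: "nat list \<Rightarrow> nat set" where
  "cuts u = {i. 1 \<le> i \<and> i < length u \<and> set (take i u) \<inter> set (drop i u) = {}}"

definition \<Delta>_prec_basis :: "nat list \<Rightarrow> (nat list \<times> nat list \<Rightarrow>\<^sub>0 'k::field)" where
  "\<Delta>_prec_basis u = (\<Sum>i | i \<in> cuts u \<and> max_letter u \<notin> set (drop i u).
      R_tensor (pack (take i u)) (pack (drop i u)))"

definition \<Delta>_succ_basis :: "nat list \<Rightarrow> (nat list \<times> nat list \<Rightarrow>\<^sub>0 'k::field)" where
  "\<Delta>_succ_basis u = (\<Sum>i | i \<in> cuts u \<and> max_letter u \<notin> set (take i u).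
      R_tensor (pack (take i u)) (pack (drop i u)))"

definition \<Delta>_prec :: "(nat list \<Rightarrow>\<^sub>0 'k::field) \<Rightarrow> (nat list \<times> nat list \<Rightarrow>\<^sub>0 'k)" where
  "\<Delta>_prec = linear_extension \<Delta>_prec_basis"

definition \<Delta>_succ :: "(nat list \<Rightarrow>\<^sub>0 'k::field) \<Rightarrow> (nat list \<times> nat list \<Rightarrow>\<^sub>0 'k)" where
  "\<Delta>_succ = linear_extension \<Delta>_succ_basis"

definition \<Delta>_tilde :: "(nat list \<Rightarrow>\<^sub>0 'k::field) \<Rightarrow> (nat list \<times> nat list \<Rightarrow>\<^sub>0 'k)" where
  "\<Delta>_tilde f = \<Delta>_prec f + \<Delta>_succ f"

definition Prim :: "(nat list \<Rightarrow>\<^sub>0 'k::field) set" where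
  "Prim = {f \<in> WQSym_plus. \<Delta>_tilde f = 0}"

definition TPrim :: "(nat list \<Rightarrow>\<^sub>0 'k::field) set" where
  "TPrim = {f \<in> WQSym_plus. \<Delta>_prec f = 0} \<inter> {f \<in> WQSym_plus. \<Delta>_succ f = 0}"

lemma finite_PW: "finite (PW n)"
proof -
  have "PW n \<subseteq> {w. set w \<subseteq> {..n} \<and> length w = n}"
  proof
    fix w assume w: "w \<in> PW n"
    then have eq: "set w = {1..max_letter w}" and len: "length w = n"
      by (auto simp: PW_def packed_def)
    have "max_letter w = card (set w)" by (subst eq) simp
    also have "\<dots> \<le> n" using card_length[of w] len by simp
    finally show "w \<in> {w. set w \<subseteq> {..n} \<and> length w = n}"
      using eq len by auto
  qed
  then show ?thesis
    using finite_lists_length_eq[of "{..n}" n] finite_subset by auto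
qed

section \<open>Packed trees and forests\<close>

datatype biplane_tree =
  Node (label: "nat list") (left_forest: "biplane_tree list") (right_forest: "biplane_tree list")

fun weight :: "biplane_tree \<Rightarrow> nat" where
  "weight (Node I ls rs) = length I + sum_list (map weight ls) + sum_list (map weight rs)"

definition forest_weight :: "biplane_tree list \<Rightarrow> nat" where
  "forest_weight f = sum_list (map weight f)"

definition right_weight :: "biplane_tree \<Rightarrow> nat" where
  "right_weight t = length (label t) + forest_weight (right_forest t)"

definition valid_label :: "nat list \<Rightarrow> bool" where
  "valid_label I \<longleftrightarrow> I \<noteq> [] \<and> sorted_wrt (<) I \<and> (\<forall>i\<in>set I. 0 < i)"

text \<open>The upper-end condition is stated over the integers to avoid truncated subtraction.\<close>

fun packed_tree :: "biplane_tree \<Rightarrow> bool" where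
  "packed_tree (Node I ls rs) \<longleftrightarrow>
     valid_label I \<and>
     (if rs = [] then \<forall>k<length I. I ! k = k + 1
      else 1 \<le> hd I \<and> hd I \<le> weight (hd rs) \<and>
           1 \<le> int (right_weight (Node I ls rs)) + 1 - int (last I) \<and>
           int (right_weight (Node I ls rs)) + 1 - int (last I) \<le> int (weight (last rs))) \<and>
     (\<forall>t\<in>set ls. packed_tree t) \<and> (\<forall>t\<in>set rs. packed_tree t)"

definition packed_forests :: "nat \<Rightarrow> biplane_tree list set" where
  "packed_forests n = {f. (\<forall>t\<in>set f. packed_tree t) \<and> forest_weight f = n}"

definition packed_trees :: "nat \<Rightarrow> biplane_tree set" where
  "packed_trees n = {t. packed_tree t \<and> weight t = n}"

definition packed_trees_no_left :: "nat \<Rightarrow> biplane_tree set" where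
  "packed_trees_no_left n = {t \<in> packed_trees n. left_forest t = []}"

lemma packed_tree_weight_pos: "packed_tree t \<Longrightarrow> 0 < weight t"
  by (cases t) (auto simp: valid_label_def)

lemma packed_tree_label_le:
  assumes "packed_tree (Node I ls rs)" "i \<in> set I"
  shows "i \<le> weight (Node I ls rs)"
proof (cases "rs = []")
  case True
  with assms obtain k where "k < length I" "i = I ! k" by (auto simp: in_set_conv_nth)
  with True assms show ?thesis by auto
next
  case False
  have I: "sorted I" "I \<noteq> []"
    using assms by (auto simp: valid_label_def strict_sorted_iff)
  obtain j where "j < length I" "i = I ! j" using assms(2) by (auto simp: in_set_conv_nth)
  then have "i \<le> last I"
    using I sorted_nth_mono[OF I(1), of j "length I - 1"] by (simp add: last_conv_nth)
  moreover have "last I \<le> right_weight (Node I ls rs)"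
    using assms False by auto
  ultimately show ?thesis
    by (simp add: right_weight_def forest_weight_def)
qed

lemma length_le_forest_weight:
  "(\<forall>t\<in>set f. packed_tree t) \<Longrightarrow> length f \<le> forest_weight f"
proof (induction f)
  case (Cons t f)
  then show ?case using packed_tree_weight_pos[of t] by (simp add: forest_weight_def)
qed (simp add: forest_weight_def)

lemma finite_packed_tree_weight_le: "finite {t. packed_tree t \<and> weight t \<le> n}"
proof (induction n)
  case 0
  have "{t. packed_tree t \<and> weight t \<le> 0} = {}" using packed_tree_weight_pos by auto
  then show ?case by (simp only: finite.emptyI)
next
  case (Suc n)
  let ?A = "{t. packed_tree t \<and> weight t \<le> n}"
  let ?L = "{xs. set xs \<subseteq> ?A \<and> length xs \<le> Suc n}"
  let ?I = "{xs. set xs \<subseteq> {..Suc n} \<and> length xs \<le> Suc n}"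
  have fin: "finite ((\<lambda>(I, ls, rs). Node I ls rs) ` (?I \<times> ?L \<times> ?L))"
    using Suc by (intro finite_imageI finite_cartesian_product finite_lists_length_le) auto
  have "{t. packed_tree t \<and> weight t \<le> Suc n} \<subseteq> (\<lambda>(I, ls, rs). Node I ls rs) ` (?I \<times> ?L \<times> ?L)"
  proof
    fix t assume "t \<in> {t. packed_tree t \<and> weight t \<le> Suc n}"
    moreover obtain I ls rs where t: "t = Node I ls rs" by (cases t)
    ultimately have pt: "packed_tree (Node I ls rs)" and w: "weight (Node I ls rs) \<le> Suc n" by auto
    have I: "0 < length I" using pt by (simp add: valid_label_def)
    have sub: "\<forall>s\<in>set ls \<union> set rs. packed_tree s" using pt by auto
    have fw: "length I + forest_weight ls + forest_weight rs \<le> Suc n"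
      using w by (simp add: forest_weight_def)
    have mem: "f \<in> ?L" if f: "\<forall>s\<in>set f. packed_tree s" and le: "forest_weight f \<le> n" for f
    proof -
      have "weight s \<le> n" if "s \<in> set f" for s
        using that le member_le_sum_list[of "weight s" "map weight f"]
        by (simp add: forest_weight_def)
      then show ?thesis using f le length_le_forest_weight[OF f] by auto
    qed
    have "i \<le> Suc n" if "i \<in> set I" for i
      using packed_tree_label_le[OF pt that] w by linarith
    then have "I \<in> ?I" using fw by auto
    moreover have "forest_weight ls \<le> n" "forest_weight rs \<le> n" using fw I by linarith+
    then have "ls \<in> ?L" "rs \<in> ?L" using sub mem[of ls] mem[of rs] by blast+
    ultimately show "t \<in> (\<lambda>(I, ls, rs). Node I ls rs) ` (?I \<times> ?L \<times> ?L)"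
      unfolding t by (intro image_eqI[where x = "(I, ls, rs)"]) simp_all
  qed
  then show ?case using fin finite_subset by blast
qed

lemma finite_packed_trees: "finite (packed_trees n)"
  by (rule finite_subset[OF _ finite_packed_tree_weight_le[of n]]) (auto simp: packed_trees_def)

lemma finite_packed_trees_no_left: "finite (packed_trees_no_left n)"
  by (rule finite_subset[OF _ finite_packed_trees[of n]]) (auto simp: packed_trees_no_left_def)

lemma finite_packed_forests: "finite (packed_forests n)"
proof -
  have "packed_forests n \<subseteq> {f. set f \<subseteq> {t. packed_tree t \<and> weight t \<le> n} \<and> length f \<le> n}"
  proof
    fix f assume "f \<in> packed_forests n"
    then have f: "\<forall>t\<in>set f. packed_tree t" "forest_weight f = n" by (auto simp: packed_forests_def)
    have "weight t \<le> n" if "t \<in> set f" for t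
      using that f(2) by (auto simp: forest_weight_def intro: member_le_sum_list)
    then show "f \<in> {f. set f \<subseteq> {t. packed_tree t \<and> weight t \<le> n} \<and> length f \<le> n}"
      using f length_le_forest_weight[OF f(1)] by auto
  qed
  then show ?thesis
    using finite_lists_length_le[OF finite_packed_tree_weight_le[of n], of n] finite_subset by blast
qed

end

theory Submission
  imports Defs
begin

text \<open>
  In the graded dual, the coproducts become products of packed words: \<open>u * v\<close>, and its halves
  \<open>u \<prec> v\<close> and \<open>u \<succ> v\<close>, are multiplicity-free sums of packed words. A (totally) primitive
  element is a functional that vanishes on all products (half-products). The dendriform axioms let
  every half-product be rewritten by the triple products \<open>a \<succ> p \<prec> b\<close> with \<open>p\<close> totally irreducible.
  The word of \<open>a \<succ> p \<prec> b\<close> with most coinversions puts \<open>a\<close> below everything and \<open>p\<close> without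
  its maximal letter below \<open>b\<close>; each non-empty packed word is this leading word for exactly one
  triple, so the equations are unitriangular and the dimension is the number of totally irreducible
  words. In the same way, primitive elements are counted by words that are not a shifted
  concatenation.

  Removing all maximal letters from a packed word and recording their positions gives the same
  recursion as removing the root of the first tree of a packed forest (the position list splits the
  forest into left forest, right forest and remaining trees), so packed words and packed forests are
  equinumerous. The remaining two counts follow, since the generating series of words and of forests
  satisfy the same equations \<open>W = 1 + I W\<close> and \<open>W = 1 + W P W\<close>, with \<open>I\<close> counting irreducible words
  or trees, and \<open>P\<close> totally irreducible words or trees with empty left forest.
\<close>

section \<open>Packing\<close>

definition rank :: "nat set \<Rightarrow> nat \<Rightarrow> nat" where
  "rank S x = card {y \<in> S. y \<le> x}"

lemma pack_conv_rank: "pack w = map (rank (set w)) w"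
  by (simp add: pack_def rank_def)

lemma length_pack [simp]: "length (pack w) = length w"
  by (simp add: pack_def)

lemma pack_Nil [simp]: "pack [] = []"
  by (simp add: pack_def)

lemma pack_eq_Nil [simp]: "pack w = [] \<longleftrightarrow> w = []"
  by (simp add: pack_def)

lemma strict_mono_on_rank: "finite S \<Longrightarrow> strict_mono_on S (rank S)"
  unfolding rank_def
  by (rule strict_mono_onI, rule psubset_card_mono) (auto simp: psubset_eq set_eq_iff not_le[symmetric])

text \<open>Packing sees only the relative order of the letters. This is what carries statements
  about blocks from a word to its packing.\<close>

lemma pack_map:
  assumes "strict_mono_on (set w) g"
  shows "pack (map g w) = pack w"
proof -
  have "card {y \<in> g ` set w. y \<le> g x} = card {y \<in> set w. y \<le> x}" if x: "x \<in> set w" for x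
  proof -
    have "g y \<le> g x \<longleftrightarrow> y \<le> x" if "y \<in> set w" for y
      using strict_mono_on_less_eq[OF assms that x] .
    then have "{y \<in> g ` set w. y \<le> g x} = g ` {y \<in> set w. y \<le> x}" by auto
    moreover have "inj_on g {y \<in> set w. y \<le> x}"
      using strict_mono_on_imp_inj_on[OF assms] by (rule inj_on_subset) auto
    ultimately show ?thesis by (simp add: card_image)
  qed
  then show ?thesis by (simp add: pack_def)
qed

lemma max_letter_eq:
  assumes "set w = {1..m}"
  shows "max_letter w = m"
proof -
  have "insert 0 (set w) = {0..m}" using assms by auto
  then show ?thesis unfolding max_letter_def by (simp add: Max_eq_iff)
qed

lemma packedI: "set w = {1..m} \<Longrightarrow> packed w"
  unfolding packed_def by (simp only: max_letter_eq)

lemma max_letter_pos: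
  assumes "packed w" "w \<noteq> []"
  shows "0 < max_letter w"
proof (rule ccontr)
  assume "\<not> 0 < max_letter w"
  then have "set w = {}" using assms(1) unfolding packed_def by simp
  then show False using assms(2) by simp
qed

lemma max_letter_in_set: "packed w \<Longrightarrow> w \<noteq> [] \<Longrightarrow> max_letter w \<in> set w"
  using max_letter_pos[of w] unfolding packed_def by simp

lemma packed_pack [simp]: "packed (pack w)"
proof (rule packedI)
  let ?S = "set w"
  have "rank ?S ` ?S \<subseteq> {1..card ?S}"
  proof
    fix r assume "r \<in> rank ?S ` ?S"
    then obtain x where x: "x \<in> ?S" "r = card {y \<in> ?S. y \<le> x}" by (auto simp: rank_def)
    then have "0 < card {y \<in> ?S. y \<le> x}" by (subst card_gt_0_iff) auto
    then show "r \<in> {1..card ?S}" using x by (auto intro: card_mono)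
  qed
  moreover have "card (rank ?S ` ?S) = card ?S"
    by (rule card_image, rule strict_mono_on_imp_inj_on, rule strict_mono_on_rank) simp
  ultimately have "rank ?S ` ?S = {1..card ?S}" by (intro card_subset_eq) auto
  then show "set (pack w) = {1..card ?S}" by (simp add: pack_conv_rank)
qed

lemma pack_packed:
  assumes "packed w"
  shows "pack w = w"
proof -
  have "card {y \<in> set w. y \<le> x} = x" if "x \<in> set w" for x
  proof -
    have "{y \<in> set w. y \<le> x} = {1..x}" using assms that by (auto simp: packed_def)
    then show ?thesis by simp
  qed
  then show ?thesis by (simp add: pack_def map_idI)
qed

lemma pack_eq_if_same_order:
  assumes len: "length w = length w'"
    and ord: "\<And>s t. s < length w \<Longrightarrow> t < length w \<Longrightarrow> w ! s \<le> w ! t \<longleftrightarrow> w' ! s \<le> w' ! t"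
  shows "pack w = pack w'"
proof -
  \<comment> \<open>By the order hypothesis in both directions, positions with equal letters in
    \<open>w\<close> have equal letters in \<open>w'\<close>, so any occurrence may serve to read
    off the relabelling.\<close>
  define g where "g x = w' ! (SOME s. s < length w \<and> w ! s = x)" for x
  have g: "g (w ! t) = w' ! t" if t: "t < length w" for t
  proof -
    let ?s = "SOME s. s < length w \<and> w ! s = w ! t"
    have s: "?s < length w \<and> w ! ?s = w ! t" by (rule someI[of _ t]) (use t in simp)
    then have "w' ! ?s \<le> w' ! t" "w' ! t \<le> w' ! ?s"
      using ord[of ?s t] ord[of t ?s] t by auto
    then show ?thesis by (simp add: g_def)
  qed
  have "strict_mono_on (set w) g"
  proof (rule strict_mono_onI)
    fix x y assume "x \<in> set w" "y \<in> set w" "x < y"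
    then obtain s t where "s < length w" "t < length w" "x = w ! s" "y = w ! t"
      by (auto simp: in_set_conv_nth)
    with \<open>x < y\<close> show "g x < g y" using ord[of t s] by (simp add: g)
  qed
  moreover have "map g w = w'" using len by (intro nth_equalityI) (auto simp: g)
  ultimately show ?thesis using pack_map by metis
qed

lemma pack_nth_le_iff:
  assumes "s < length w" "t < length w"
  shows "pack w ! s \<le> pack w ! t \<longleftrightarrow> w ! s \<le> w ! t"
  using assms strict_mono_on_less_eq[OF strict_mono_on_rank, of "set w" "w ! s" "w ! t"]
  by (simp add: pack_conv_rank)

lemma same_order_if_pack_eq:
  assumes "pack w = pack w'" "s < length w" "t < length w"
  shows "w ! s \<le> w ! t \<longleftrightarrow> w' ! s \<le> w' ! t"
proof -
  have "length w' = length w" using arg_cong[OF assms(1), of length] by simp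
  then show ?thesis using assms pack_nth_le_iff[of s w t] pack_nth_le_iff[of s w' t] by simp
qed

lemma PW_iff: "w \<in> PW n \<longleftrightarrow> packed w \<and> length w = n"
  by (simp add: PW_def)


section \<open>Relative position of blocks\<close>

definition below :: "nat list \<Rightarrow> nat list \<Rightarrow> bool" where
  "below x y \<longleftrightarrow> (\<forall>c\<in>set x. \<forall>d\<in>set y. c < d)"

text \<open>For \<open>y @ z\<close> this says that the maximal letter does not occur in \<open>z\<close>.\<close>

definition lower :: "nat list \<Rightarrow> nat list \<Rightarrow> bool" where
  "lower z y \<longleftrightarrow> (\<forall>d\<in>set z. \<exists>c\<in>set y. d < c)"

text \<open>The maximal letter of \<open>y @ z\<close> occurs only in \<open>y\<close>, and apart from it \<open>y\<close> lies below \<open>z\<close>.\<close>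

definition topped :: "nat list \<Rightarrow> nat list \<Rightarrow> bool" where
  "topped y z \<longleftrightarrow> lower z y \<and>
     (\<forall>c\<in>set y. (\<forall>c'\<in>set y. c' \<le> c) \<or> (\<forall>d\<in>set z. c < d))"

definition apart :: "nat list \<Rightarrow> nat list \<Rightarrow> bool" where
  "apart x y \<longleftrightarrow> set x \<inter> set y = {}"

lemma apart_append [simp]:
  "apart (x @ y) z \<longleftrightarrow> apart x z \<and> apart y z" "apart z (x @ y) \<longleftrightarrow> apart z x \<and> apart z y"
  by (auto simp: apart_def)

lemma apart_Nil [simp]: "apart [] x" "apart x []"
  by (auto simp: apart_def)

lemma lower_Nil [simp]: "lower [] x" "lower x [] \<longleftrightarrow> x = []"
  by (auto simp: lower_def)

lemma lower_append_left [simp]: "lower (x @ y) z \<longleftrightarrow> lower x z \<and> lower y z"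
  by (auto simp: lower_def)

text \<open>By transitivity, a block that is lower than another contributes nothing to the maximum
  of the two together. This is how nested half-products flatten.\<close>

lemma lower_absorb:
  "lower x y \<Longrightarrow> lower z (x @ y) \<longleftrightarrow> lower z y" "lower y x \<Longrightarrow> lower z (x @ y) \<longleftrightarrow> lower z x"
  unfolding lower_def set_append by (meson UnE UnI1 UnI2 less_trans)+

lemma below_imp_apart: "below x y \<Longrightarrow> apart x y"
  by (auto simp: below_def apart_def)

lemma below_imp_lower: "below x y \<Longrightarrow> y \<noteq> [] \<Longrightarrow> lower x y"
  by (cases y) (auto simp: below_def lower_def)

lemma below_append [simp]:
  "below (x @ y) z \<longleftrightarrow> below x z \<and> below y z" "below z (x @ y) \<longleftrightarrow> below z x \<and> below z y"
  by (auto simp: below_def)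

lemma below_Nil [simp]: "below [] x" "below x []"
  by (auto simp: below_def)

lemma topped_imp_apart: "topped x y \<Longrightarrow> apart x y"
  unfolding topped_def apart_def lower_def by (meson disjoint_iff leD less_irrefl)

lemma topped_Nil [simp]: "topped x []" "topped [] x \<longleftrightarrow> x = []"
  by (auto simp: topped_def)

text \<open>All four relations only compare letters, so an order embedding preserves and reflects
  them. The embedding used later is the ranking of the letters of the whole word.\<close>

lemma
  assumes "strict_mono_on (set x \<union> set y) g"
  shows below_map: "below (map g x) (map g y) \<longleftrightarrow> below x y"
    and lower_map: "lower (map g x) (map g y) \<longleftrightarrow> lower x y"
    and topped_map: "topped (map g x) (map g y) \<longleftrightarrow> topped x y"
    and apart_map: "apart (map g x) (map g y) \<longleftrightarrow> apart x y"
proof -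
  have le: "g a \<le> g b \<longleftrightarrow> a \<le> b" and less: "g a < g b \<longleftrightarrow> a < b"
    if "a \<in> set x \<union> set y" "b \<in> set x \<union> set y" for a b
    using strict_mono_on_less_eq[OF assms that] strict_mono_on_less[OF assms that] by auto
  have inj: "inj_on g (set x \<union> set y)" using assms by (rule strict_mono_on_imp_inj_on)
  show "below (map g x) (map g y) \<longleftrightarrow> below x y"
    unfolding below_def by (auto simp: less)
  show *: "lower (map g x) (map g y) \<longleftrightarrow> lower x y"
    unfolding lower_def by (auto simp: less)
  have *: "lower (map g y) (map g x) \<longleftrightarrow> lower y x"
    unfolding lower_def by (auto simp: less)
  show "topped (map g x) (map g y) \<longleftrightarrow> topped x y"
    unfolding topped_def * by (simp add: less le)
  show "apart (map g x) (map g y) \<longleftrightarrow> apart x y"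
    unfolding apart_def using inj by (auto simp: inj_on_def)
qed

lemma strict_mono_on_rank_subset: "A \<subseteq> S \<Longrightarrow> finite S \<Longrightarrow> strict_mono_on A (rank S)"
  by (rule monotone_on_subset[OF strict_mono_on_rank])

text \<open>\<open>pack\<close> acts letterwise, so factorizations of \<open>pack w\<close>
  correspond to factorizations of \<open>w\<close>.\<close>

lemma map_split:
  "(\<exists>x y. map f w = x @ y \<and> Q x y) \<longleftrightarrow> (\<exists>x y. w = x @ y \<and> Q (map f x) (map f y))"
proof (intro iffI; elim exE conjE)
  fix x y assume *: "map f w = x @ y" "Q x y"
  from *(1) obtain x' y' where "w = x' @ y'" "x = map f x'" "y = map f y'"
    by (auto simp: map_eq_append_conv)
  with *(2) show "\<exists>x y. w = x @ y \<and> Q (map f x) (map f y)" by auto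
next
  fix x y assume "w = x @ y" "Q (map f x) (map f y)"
  then show "\<exists>x y. map f w = x @ y \<and> Q x y"
    by (intro exI[of _ "map f x"] exI[of _ "map f y"]) simp
qed

lemma map_split3:
  "(\<exists>x y z. map f w = x @ y @ z \<and> Q x y z) \<longleftrightarrow>
   (\<exists>x y z. w = x @ y @ z \<and> Q (map f x) (map f y) (map f z))"
proof (intro iffI; elim exE conjE)
  fix x y z assume *: "map f w = x @ y @ z" "Q x y z"
  from *(1) obtain x' y' z' where "w = x' @ y' @ z'" "x = map f x'" "y = map f y'" "z = map f z'"
    by (metis map_eq_append_conv)
  with *(2) show "\<exists>x y z. w = x @ y @ z \<and> Q (map f x) (map f y) (map f z)" by auto
next
  fix x y z assume "w = x @ y @ z" "Q (map f x) (map f y) (map f z)"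
  then show "\<exists>x y z. map f w = x @ y @ z \<and> Q x y z"
    by (intro exI[of _ "map f x"] exI[of _ "map f y"] exI[of _ "map f z"]) simp
qed


section \<open>Supports of dual products\<close>

text \<open>
  The dual products of two basis vectors are multiplicity-free, so only their supports are recorded.
\<close>

definition prod_set :: "nat list \<Rightarrow> nat list \<Rightarrow> nat list set" where
  "prod_set u v = {w. packed w \<and> (\<exists>x y. w = x @ y \<and> apart x y \<and> pack x = u \<and> pack y = v)}"

definition prec_set :: "nat list \<Rightarrow> nat list \<Rightarrow> nat list set" where
  "prec_set u v = {w. packed w \<and>
     (\<exists>x y. w = x @ y \<and> apart x y \<and> lower y x \<and> pack x = u \<and> pack y = v)}"

definition succ_set :: "nat list \<Rightarrow> nat list \<Rightarrow> nat list set" where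
  "succ_set u v = {w. packed w \<and>
     (\<exists>x y. w = x @ y \<and> apart x y \<and> lower x y \<and> pack x = u \<and> pack y = v)}"

text \<open>The support of the threefold product \<open>a \<succ> p \<prec> b\<close>.\<close>

definition triple_set :: "nat list \<Rightarrow> nat list \<Rightarrow> nat list \<Rightarrow> nat list set" where
  "triple_set a p b = {w. packed w \<and>
     (\<exists>x y z. w = x @ y @ z \<and> apart x y \<and> apart x z \<and> apart y z \<and> lower x y \<and> lower z y \<and>
        pack x = a \<and> pack y = p \<and> pack z = b)}"

lemmas rank_map_simps =
  pack_map le_supI1 le_supI2 strict_mono_on_rank_subset below_map lower_map topped_map apart_map

text \<open>Lets a factor be taken apart further without packing it first, so that iterated products
  become conditions on the blocks of a single word.\<close>

lemma pack_in_prod_set: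
  "pack w \<in> prod_set u v \<longleftrightarrow> (\<exists>x y. w = x @ y \<and> apart x y \<and> pack x = u \<and> pack y = v)"
  unfolding prod_set_def mem_Collect_eq pack_conv_rank[of w] map_split
  by (simp add: rank_map_simps pack_conv_rank[symmetric] cong: conj_cong)

lemma pack_in_prec_set:
  "pack w \<in> prec_set u v \<longleftrightarrow>
     (\<exists>x y. w = x @ y \<and> apart x y \<and> lower y x \<and> pack x = u \<and> pack y = v)"
  unfolding prec_set_def mem_Collect_eq pack_conv_rank[of w] map_split
  by (simp add: rank_map_simps pack_conv_rank[symmetric] cong: conj_cong)

lemma pack_in_triple_set:
  "pack w \<in> triple_set a p b \<longleftrightarrow>
     (\<exists>x y z. w = x @ y @ z \<and> apart x y \<and> apart x z \<and> apart y z \<and> lower x y \<and> lower z y \<and>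
        pack x = a \<and> pack y = p \<and> pack z = b)"
  unfolding triple_set_def mem_Collect_eq pack_conv_rank[of w] map_split3
  by (simp add: rank_map_simps pack_conv_rank[symmetric] cong: conj_cong)

lemma in_setD:
  "w \<in> prod_set u v \<Longrightarrow> w \<in> PW (length u + length v)"
  "w \<in> prec_set u v \<Longrightarrow> w \<in> PW (length u + length v)"
  "w \<in> succ_set u v \<Longrightarrow> w \<in> PW (length u + length v)"
  "w \<in> triple_set a p b \<Longrightarrow> w \<in> PW (length a + length p + length b)"
  by (auto simp: prod_set_def prec_set_def succ_set_def triple_set_def PW_iff)

lemma in_set_take_drop:
  "w \<in> prod_set u v \<Longrightarrow> pack (take (length u) w) = u \<and> pack (drop (length u) w) = v"
  "w \<in> prec_set u v \<Longrightarrow> pack (take (length u) w) = u \<and> pack (drop (length u) w) = v"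
  "w \<in> succ_set u v \<Longrightarrow> pack (take (length u) w) = u \<and> pack (drop (length u) w) = v"
  "w \<in> triple_set a p b \<Longrightarrow> pack (take (length a) w) = a \<and>
     pack (take (length p) (drop (length a) w)) = p \<and> pack (drop (length p) (drop (length a) w)) = b"
  by (auto simp: prod_set_def prec_set_def succ_set_def triple_set_def)

lemma finite_sets [simp]:
  "finite (prod_set u v)" "finite (prec_set u v)" "finite (succ_set u v)" "finite (triple_set a p b)"
  by (rule finite_subset[OF _ finite_PW], rule subsetI, erule in_setD)+

lemma pack_append_in_sets:
  "apart x y \<Longrightarrow> pack (x @ y) \<in> prod_set (pack x) (pack y)"
  "apart x y \<Longrightarrow> lower y x \<Longrightarrow> pack (x @ y) \<in> prec_set (pack x) (pack y)"
  "apart x y \<Longrightarrow> apart x z \<Longrightarrow> apart y z \<Longrightarrow> lower x y \<Longrightarrow> lower z y \<Longrightarrow>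
    pack (x @ y @ z) \<in> triple_set (pack x) (pack y) (pack z)"
  unfolding pack_in_prod_set pack_in_prec_set pack_in_triple_set by blast+

text \<open>The lengths of the leading factors locate the cuts, and then every factor can be read
  off from the word. Equal lengths are therefore assumed only where the first factor varies.\<close>

lemma sets_disjoint:
  assumes "d \<noteq> d'"
  shows "length d = length d' \<Longrightarrow> prod_set d v \<inter> prod_set d' v = {}" "prod_set v d \<inter> prod_set v d' = {}"
    "length d = length d' \<Longrightarrow> prec_set d v \<inter> prec_set d' v = {}" "succ_set v d \<inter> succ_set v d' = {}"
    "triple_set a p d \<inter> triple_set a p d' = {}"
    "length d = length d' \<Longrightarrow> triple_set d p b \<inter> triple_set d' p b = {}"
proof -
  show "length d = length d' \<Longrightarrow> prod_set d v \<inter> prod_set d' v = {}"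
    using assms by (metis disjoint_iff in_set_take_drop(1))
  show "prod_set v d \<inter> prod_set v d' = {}"
    using assms by (metis disjoint_iff in_set_take_drop(1))
  show "length d = length d' \<Longrightarrow> prec_set d v \<inter> prec_set d' v = {}"
    using assms by (metis disjoint_iff in_set_take_drop(2))
  show "succ_set v d \<inter> succ_set v d' = {}"
    using assms by (metis disjoint_iff in_set_take_drop(3))
  show "triple_set a p d \<inter> triple_set a p d' = {}"
    using assms by (metis disjoint_iff in_set_take_drop(4))
  show "length d = length d' \<Longrightarrow> triple_set d p b \<inter> triple_set d' p b = {}"
    using assms by (metis disjoint_iff in_set_take_drop(4))
qed

section \<open>Dendriform identities on supports\<close>

lemma regroup:
  "(\<exists>q t. w = q @ t \<and> C q t \<and> (\<exists>x y. q = x @ y \<and> D x y)) \<longleftrightarrow>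
   (\<exists>x y t. w = x @ y @ t \<and> C (x @ y) t \<and> D x y)"
  "(\<exists>q t. w = q @ t \<and> C q t \<and> (\<exists>x y z. q = x @ y @ z \<and> E x y z)) \<longleftrightarrow>
   (\<exists>x y z t. w = x @ y @ z @ t \<and> C (x @ y @ z) t \<and> E x y z)"
  "(\<exists>q y z. w = q @ y @ z \<and> E q y z \<and> (\<exists>t x. q = t @ x \<and> D t x)) \<longleftrightarrow>
   (\<exists>t x y z. w = t @ x @ y @ z \<and> E (t @ x) y z \<and> D t x)"
  by (metis append_assoc)+

text \<open>The identity \<open>(a \<succ> p \<prec> b) \<prec> v = a \<succ> p \<prec> (b *
  v)\<close>: both sides describe four pairwise letter-disjoint blocks, with the maximal letter in
  the second one.\<close>

lemma UN_triple_prec: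
  "(\<Union>d\<in>triple_set a p b. prec_set d v) = (\<Union>e\<in>prod_set b v. triple_set a p e)" (is "?A = ?B")
proof (rule set_eqI)
  fix w
  have "w \<in> ?A \<longleftrightarrow> packed w \<and> (\<exists>q t. w = q @ t \<and> (apart q t \<and> lower t q \<and> pack t = v) \<and>
      pack q \<in> triple_set a p b)"
    by (auto simp: prec_set_def)
  also have "\<dots> \<longleftrightarrow> packed w \<and> (\<exists>x y z t. w = x @ y @ z @ t \<and>
      ((apart x y \<and> apart x (z @ t) \<and> apart y (z @ t) \<and> lower x y \<and> lower (z @ t) y \<and>
        pack x = a \<and> pack y = p) \<and> (apart z t \<and> pack z = b \<and> pack t = v)))"
    unfolding pack_in_triple_set regroup by (rule conj_cong[OF refl], (rule ex_cong1)+, rule conj_cong[OF refl], auto simp: lower_absorb)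
  also have "\<dots> \<longleftrightarrow> packed w \<and> (\<exists>x y s. w = x @ y @ s \<and>
      (apart x y \<and> apart x s \<and> apart y s \<and> lower x y \<and> lower s y \<and> pack x = a \<and> pack y = p) \<and>
      pack s \<in> prod_set b v)"
    unfolding pack_in_prod_set by fast
  also have "\<dots> \<longleftrightarrow> w \<in> ?B"
    by (auto simp: triple_set_def)
  finally show "w \<in> ?A \<longleftrightarrow> w \<in> ?B" .
qed

text \<open>The mirror identity \<open>v \<succ> (a \<succ> p \<prec> b) = (v * a) \<succ> p \<prec>
  b\<close>; here the maximal letter lies in the third of the four blocks.\<close>

lemma UN_triple_succ:
  "(\<Union>d\<in>triple_set a p b. succ_set v d) = (\<Union>e\<in>prod_set v a. triple_set e p b)" (is "?A = ?B")
proof (rule set_eqI)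
  fix w
  have "w \<in> ?A \<longleftrightarrow> packed w \<and> (\<exists>t q. w = t @ q \<and> (apart t q \<and> lower t q \<and> pack t = v) \<and>
      pack q \<in> triple_set a p b)"
    by (auto simp: succ_set_def)
  also have "\<dots> \<longleftrightarrow> packed w \<and> (\<exists>t x y z. w = t @ x @ y @ z \<and>
      (apart t (x @ y @ z) \<and> lower t (x @ y @ z) \<and> pack t = v) \<and>
      (apart x y \<and> apart x z \<and> apart y z \<and> lower x y \<and> lower z y \<and> pack x = a \<and> pack y = p \<and> pack z = b))"
    unfolding pack_in_triple_set by fast
  also have "\<dots> \<longleftrightarrow> packed w \<and> (\<exists>t x y z. w = t @ x @ y @ z \<and>
      (apart (t @ x) y \<and> apart (t @ x) z \<and> apart y z \<and> lower (t @ x) y \<and> lower z y \<and>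
        pack y = p \<and> pack z = b) \<and> (apart t x \<and> pack t = v \<and> pack x = a))"
    by (rule conj_cong[OF refl], (rule ex_cong1)+, rule conj_cong[OF refl], auto simp: lower_absorb)
  also have "\<dots> \<longleftrightarrow> packed w \<and> (\<exists>s y z. w = s @ y @ z \<and> (apart s y \<and> apart s z \<and> apart y z \<and>
      lower s y \<and> lower z y \<and> pack y = p \<and> pack z = b) \<and> pack s \<in> prod_set v a)"
    unfolding pack_in_prod_set regroup ..
  also have "\<dots> \<longleftrightarrow> w \<in> ?B"
    by (auto simp: triple_set_def)
  finally show "w \<in> ?A \<longleftrightarrow> w \<in> ?B" .
qed

text \<open>Associativity of the product: both sides describe three pairwise letter-disjoint
  blocks.\<close>

lemma UN_prod_prod:
  "(\<Union>d\<in>prod_set a u. prod_set d v) = (\<Union>e\<in>prod_set u v. prod_set a e)" (is "?A = ?B")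
proof (rule set_eqI)
  fix w
  have "w \<in> ?A \<longleftrightarrow> packed w \<and> (\<exists>q t. w = q @ t \<and> (apart q t \<and> pack t = v) \<and> pack q \<in> prod_set a u)"
    by (auto simp: prod_set_def[of _ v])
  also have "\<dots> \<longleftrightarrow> packed w \<and> (\<exists>x y t. w = x @ y @ t \<and>
      (apart x (y @ t) \<and> pack x = a) \<and> (apart y t \<and> pack y = u \<and> pack t = v))"
    unfolding pack_in_prod_set regroup by (rule conj_cong[OF refl], (rule ex_cong1)+, rule conj_cong[OF refl], auto)
  also have "\<dots> \<longleftrightarrow> packed w \<and> (\<exists>x s. w = x @ s \<and> (apart x s \<and> pack x = a) \<and> pack s \<in> prod_set u v)"
    unfolding pack_in_prod_set by fast
  also have "\<dots> \<longleftrightarrow> w \<in> ?B"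
    by (auto simp: prod_set_def[of a])
  finally show "w \<in> ?A \<longleftrightarrow> w \<in> ?B" .
qed

text \<open>Brackets the triple product as the iterated half-product
  \<open>a \<succ> (p \<prec> b)\<close>.\<close>

lemma triple_set_conv_UN:
  "triple_set a p b = (\<Union>e\<in>prec_set p b. succ_set a e)" (is "?A = ?B")
proof (rule set_eqI)
  fix w
  have "w \<in> ?B \<longleftrightarrow> packed w \<and> (\<exists>x s. w = x @ s \<and> (apart x s \<and> lower x s \<and> pack x = a) \<and>
      pack s \<in> prec_set p b)"
    by (auto simp: succ_set_def)
  also have "\<dots> \<longleftrightarrow> packed w \<and> (\<exists>x y z. w = x @ y @ z \<and> (apart x (y @ z) \<and> lower x (y @ z) \<and> pack x = a) \<and>
      (apart y z \<and> lower z y \<and> pack y = p \<and> pack z = b))"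
    unfolding pack_in_prec_set by fast
  also have "\<dots> \<longleftrightarrow> w \<in> ?A"
    unfolding triple_set_def mem_Collect_eq
    by (rule conj_cong[OF refl], (rule ex_cong1)+, rule conj_cong[OF refl], auto simp: lower_absorb)
  finally show "w \<in> ?A \<longleftrightarrow> w \<in> ?B" ..
qed

text \<open>The unions above are disjoint by \<open>sets_disjoint\<close>, whose length conditions
  are met because all words of one product have the same length. Hence the identities hold for the
  values of an arbitrary functional.\<close>

lemma
  fixes f :: "nat list \<Rightarrow> 'c::comm_monoid_add"
  shows sum_triple_prec: "(\<Sum>d\<in>triple_set a p b. sum f (prec_set d v))
      = (\<Sum>e\<in>prod_set b v. sum f (triple_set a p e))" (is ?P1)
    and sum_triple_succ: "(\<Sum>d\<in>triple_set a p b. sum f (succ_set v d))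
      = (\<Sum>e\<in>prod_set v a. sum f (triple_set e p b))" (is ?P2)
    and sum_prod_prod: "(\<Sum>d\<in>prod_set a u. sum f (prod_set d v))
      = (\<Sum>e\<in>prod_set u v. sum f (prod_set a e))" (is ?P3)
    and sum_triple: "sum f (triple_set a p b) = (\<Sum>e\<in>prec_set p b. sum f (succ_set a e))" (is ?P4)
proof -
  have len: "length d = length d'" if "d \<in> prod_set u v" "d' \<in> prod_set u v" for d d' u v
    using that[THEN in_setD(1)] by (simp add: PW_iff)
  have len': "length d = length d'" if "d \<in> triple_set a p b" "d' \<in> triple_set a p b" for d d' a p b
    using that[THEN in_setD(4)] by (simp add: PW_iff)
  show ?P1
  proof -
    have "(\<Sum>d\<in>triple_set a p b. sum f (prec_set d v)) = sum f (\<Union>d\<in>triple_set a p b. prec_set d v)"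
      by (rule sum.UNION_disjoint[symmetric]) (auto intro!: sets_disjoint intro: len len')
    also have "\<dots> = (\<Sum>e\<in>prod_set b v. sum f (triple_set a p e))"
      unfolding UN_triple_prec by (rule sum.UNION_disjoint) (auto intro!: sets_disjoint intro: len len')
    finally show ?thesis .
  qed
  show ?P2
  proof -
    have "(\<Sum>d\<in>triple_set a p b. sum f (succ_set v d)) = sum f (\<Union>d\<in>triple_set a p b. succ_set v d)"
      by (rule sum.UNION_disjoint[symmetric]) (auto intro!: sets_disjoint intro: len len')
    also have "\<dots> = (\<Sum>e\<in>prod_set v a. sum f (triple_set e p b))"
      unfolding UN_triple_succ by (rule sum.UNION_disjoint) (auto intro!: sets_disjoint intro: len len')
    finally show ?thesis .
  qed
  show ?P3
  proof -
    have "(\<Sum>d\<in>prod_set a u. sum f (prod_set d v)) = sum f (\<Union>d\<in>prod_set a u. prod_set d v)"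
      by (rule sum.UNION_disjoint[symmetric]) (auto intro!: sets_disjoint intro: len len')
    also have "\<dots> = (\<Sum>e\<in>prod_set u v. sum f (prod_set a e))"
      unfolding UN_prod_prod by (rule sum.UNION_disjoint) (auto intro!: sets_disjoint intro: len len')
    finally show ?thesis .
  qed
  show ?P4
    unfolding triple_set_conv_UN
    by (rule sum.UNION_disjoint) (simp_all add: sets_disjoint)
qed

section \<open>Triangularity\<close>

definition coinv :: "nat list \<Rightarrow> (nat \<times> nat) set" where
  "coinv w = {(s, t). s < t \<and> t < length w \<and> w ! s < w ! t}"

lemma finite_coinv: "finite (coinv w)"
  by (rule finite_subset[of _ "{..<length w} \<times> {..<length w}"]) (auto simp: coinv_def)

definition refines :: "nat list \<Rightarrow> nat list \<Rightarrow> bool" where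
  "refines w l \<longleftrightarrow> length w = length l \<and> (\<forall>s t. s < t \<longrightarrow> t < length w \<longrightarrow>
     (w ! s < w ! t \<longrightarrow> l ! s < l ! t) \<and> (w ! s = w ! t \<longleftrightarrow> l ! s = l ! t))"

text \<open>Every coinversion of \<open>w\<close> is one of \<open>l\<close>. If there were no
  others, the coinversions and the common equality pattern would give both words the same relative
  order, and packed words with the same relative order are equal.\<close>

lemma refines_imp_coinv_less:
  assumes "refines w l" and "packed w" "packed l" and "w \<noteq> l"
  shows "card (coinv w) < card (coinv l)"
proof -
  have len: "length w = length l"
    and less: "\<And>s t. s < t \<Longrightarrow> t < length w \<Longrightarrow> w ! s < w ! t \<Longrightarrow> l ! s < l ! t"
    and eq: "\<And>s t. s < t \<Longrightarrow> t < length w \<Longrightarrow> w ! s = w ! t \<longleftrightarrow> l ! s = l ! t"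
    using assms(1) by (auto simp: refines_def)
  have sub: "coinv w \<subseteq> coinv l" using len less by (auto simp: coinv_def)
  moreover have "coinv w \<noteq> coinv l"
  proof
    assume C: "coinv w = coinv l"
    have lt: "w ! s < w ! t \<longleftrightarrow> l ! s < l ! t" if "s < t" "t < length w" for s t
    proof -
      have "(s, t) \<in> coinv w \<longleftrightarrow> (s, t) \<in> coinv l" using C by simp
      then show ?thesis using that len by (simp add: coinv_def)
    qed
    have "w ! s \<le> w ! t \<longleftrightarrow> l ! s \<le> l ! t" if "s < length w" "t < length w" for s t
      using lt[of s t] lt[of t s] eq[of s t] eq[of t s] that
      by (cases s t rule: linorder_cases) auto
    then have "pack w = pack l" using len by (intro pack_eq_if_same_order) auto
    then show False using assms by (simp add: pack_packed)
  qed
  ultimately show ?thesis by (intro psubset_card_mono finite_coinv) auto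
qed

lemma refines_if_pack_eq:
  assumes "pack x = pack x'"
  shows "refines x x'"
proof -
  have "length x = length x'" using arg_cong[OF assms, of length] by simp
  have "(x ! s < x ! t \<longrightarrow> x' ! s < x' ! t) \<and> (x ! s = x ! t \<longleftrightarrow> x' ! s = x' ! t)"
    if "s < t" "t < length x" for s t
  proof -
    have "x ! s \<le> x ! t \<longleftrightarrow> x' ! s \<le> x' ! t" "x ! t \<le> x ! s \<longleftrightarrow> x' ! t \<le> x' ! s"
      using that same_order_if_pack_eq[OF assms] by auto
    then show ?thesis by auto
  qed
  then show ?thesis using \<open>length x = length x'\<close> by (simp add: refines_def)
qed

text \<open>Within a block the relation is inherited. Across the blocks letters never agree, so only
  the increasing pairs need a hypothesis.\<close>

lemma refines_append:
  assumes x: "refines x x'" and y: "refines y y'" and apart: "apart x y" "apart x' y'"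
    and less: "\<And>s t. s < length x \<Longrightarrow> t < length y \<Longrightarrow> x ! s < y ! t \<Longrightarrow> x' ! s < y' ! t"
  shows "refines (x @ y) (x' @ y')"
proof -
  have len: "length x' = length x" "length y' = length y" using x y by (auto simp: refines_def)
  have neq: "x ! s \<noteq> y ! t" "x' ! s \<noteq> y' ! t" if "s < length x" "t < length y" for s t
    using apart that len by (auto simp: apart_def disjoint_iff in_set_conv_nth)
  show ?thesis
    unfolding refines_def
  proof (intro conjI allI impI)
    fix s t assume st: "s < t" "t < length (x @ y)"
    consider "t < length x" | "s < length x" "length x \<le> t" | "length x \<le> s" by linarith
    then have "((x @ y) ! s < (x @ y) ! t \<longrightarrow> (x' @ y') ! s < (x' @ y') ! t) \<and>
      ((x @ y) ! s = (x @ y) ! t \<longleftrightarrow> (x' @ y') ! s = (x' @ y') ! t)"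
    proof cases
      case 1
      then show ?thesis using st x by (auto simp: refines_def nth_append len)
    next
      case 2
      then show ?thesis using st less[of s "t - length x"] neq[of s "t - length x"]
        by (auto simp: nth_append len)
    next
      case 3
      then show ?thesis using st y by (auto simp: refines_def nth_append len)
    qed
    then show "(x @ y) ! s < (x @ y) ! t \<Longrightarrow> (x' @ y') ! s < (x' @ y') ! t"
      "(x @ y) ! s = (x @ y) ! t \<longleftrightarrow> (x' @ y') ! s = (x' @ y') ! t" by auto
  qed (simp add: len)
qed

lemma below_nth: "below x y \<Longrightarrow> s < length x \<Longrightarrow> t < length y \<Longrightarrow> x ! s < y ! t"
  by (simp add: below_def)

lemma length_eq_if_pack_eq: "pack x = pack x' \<Longrightarrow> length x = length x'"
  by (metis length_pack)

text \<open>When \<open>x\<close> lies below \<open>y\<close>, every pair across the cut is a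
  coinversion, while the order inside the blocks is fixed by the packings.\<close>

lemma lead_prod_set:
  assumes "packed (x @ y)" "below x y"
  shows "x @ y \<in> prod_set (pack x) (pack y)"
    and "w \<in> prod_set (pack x) (pack y) \<Longrightarrow> w \<noteq> x @ y \<Longrightarrow> card (coinv w) < card (coinv (x @ y))"
proof -
  show "x @ y \<in> prod_set (pack x) (pack y)"
    using assms below_imp_apart unfolding prod_set_def by blast
  assume "w \<in> prod_set (pack x) (pack y)" and neq: "w \<noteq> x @ y"
  then obtain x1 y1 where w: "packed w" "w = x1 @ y1" "apart x1 y1" "pack x1 = pack x" "pack y1 = pack y"
    by (auto simp: prod_set_def)
  have "refines (x1 @ y1) (x @ y)"
    using w assms length_eq_if_pack_eq[OF w(4)] length_eq_if_pack_eq[OF w(5)]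
    by (intro refines_append refines_if_pack_eq) (auto simp: below_imp_apart below_nth)
  then show "card (coinv w) < card (coinv (x @ y))"
    using refines_imp_coinv_less[of w] w assms neq by blast
qed

text \<open>Across the blocks, the only pairs that are not coinversions consist of a maximal letter
  of \<open>y\<close> and a letter of \<open>z\<close>, and these pairs fail in every word of the
  triple product.\<close>

lemma lead_triple_set:
  assumes "packed (x @ y @ z)" "below x (y @ z)" "topped y z" "y \<noteq> []"
  shows "x @ y @ z \<in> triple_set (pack x) (pack y) (pack z)"
    and "w \<in> triple_set (pack x) (pack y) (pack z) \<Longrightarrow> w \<noteq> x @ y @ z \<Longrightarrow>
      card (coinv w) < card (coinv (x @ y @ z))"
proof -
  have *: "apart x y" "apart x z" "apart y z" "lower x y" "lower z y"
    using assms by (auto simp: below_imp_apart topped_imp_apart below_imp_lower topped_def)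
  then show "x @ y @ z \<in> triple_set (pack x) (pack y) (pack z)"
    using assms(1) unfolding triple_set_def by blast
  assume "w \<in> triple_set (pack x) (pack y) (pack z)" and neq: "w \<noteq> x @ y @ z"
  then obtain x1 y1 z1 where w: "packed w" "w = x1 @ y1 @ z1"
    "apart x1 y1" "apart x1 z1" "apart y1 z1" "lower x1 y1" "lower z1 y1"
    and pk: "pack x1 = pack x" "pack y1 = pack y" "pack z1 = pack z"
    unfolding triple_set_def by blast
  note len = pk[THEN length_eq_if_pack_eq]
  have yz: "y ! s < z ! t" if st: "s < length y1" "t < length z1" "y1 ! s < z1 ! t" for s t
  proof (rule ccontr)
    assume "\<not> y ! s < z ! t"
    then have "\<forall>c'\<in>set y. c' \<le> y ! s" using assms(3) st len by (auto simp: topped_def)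
    then have "y ! r \<le> y ! s" if "r < length y" for r using that by simp
    \<comment> \<open>The packings of \<open>y\<close> and \<open>y1\<close> agree, so position
      \<open>s\<close> carries the maximal letter in both.\<close>
    then have max: "y1 ! r \<le> y1 ! s" if "r < length y1" for r
      using that same_order_if_pack_eq[OF pk(2), of r s] st len by simp
    obtain c where "c \<in> set y1" "z1 ! t < c" using w(7) st(2) nth_mem unfolding lower_def by blast
    then obtain r where "r < length y1" "z1 ! t < y1 ! r" by (auto simp: in_set_conv_nth)
    then show False using max[of r] st(3) by simp
  qed
  have "refines (y1 @ z1) (y @ z)"
    using w * pk yz by (intro refines_append refines_if_pack_eq) auto
  moreover have "x ! s < (y @ z) ! t" if "s < length x1" "t < length (y1 @ z1)" for s t
    using that below_nth[OF assms(2), of s t] len by simp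
  ultimately have "refines (x1 @ y1 @ z1) (x @ y @ z)"
    using w * pk by (intro refines_append[of x1 x]) (simp_all add: refines_if_pack_eq)
  then show "card (coinv w) < card (coinv (x @ y @ z))"
    using refines_imp_coinv_less[of w] w assms neq by blast
qed

section \<open>Irreducible words and unique decompositions\<close>

definition irreducible_word :: "nat list \<Rightarrow> bool" where
  "irreducible_word w \<longleftrightarrow> w \<noteq> [] \<and> \<not> (\<exists>x y. w = x @ y \<and> x \<noteq> [] \<and> y \<noteq> [] \<and> below x y)"

text \<open>Excludes the nontrivial ways to write \<open>w\<close> as the leading word of a triple
  product. In the second alternative \<open>x\<close> is nonempty automatically, since
  \<open>topped [] y\<close> forces \<open>y = []\<close>.\<close>

definition tot_irreducible :: "nat list \<Rightarrow> bool" where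
  "tot_irreducible w \<longleftrightarrow> w \<noteq> [] \<and>
     \<not> (\<exists>x y. w = x @ y \<and> (x \<noteq> [] \<and> y \<noteq> [] \<and> below x y \<or> y \<noteq> [] \<and> topped x y))"

lemma irreducible_word_pack [simp]: "irreducible_word (pack w) \<longleftrightarrow> irreducible_word w"
  unfolding irreducible_word_def pack_conv_rank[of w] map_split
  by (simp add: rank_map_simps cong: conj_cong)

lemma tot_irreducible_pack [simp]: "tot_irreducible (pack w) \<longleftrightarrow> tot_irreducible w"
  unfolding tot_irreducible_def pack_conv_rank[of w] map_split
  by (simp add: rank_map_simps cong: conj_cong)

text \<open>The shortest nonempty prefix that lies below the rest cannot be split again.\<close>

lemma irreducible_word_decomposition:
  assumes "w \<noteq> []"
  shows "\<exists>x y. w = x @ y \<and> below x y \<and> irreducible_word x"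
proof -
  obtain x where x: "x \<noteq> [] \<and> (\<exists>y. w = x @ y \<and> below x y)"
    and min: "\<And>x'. x' \<noteq> [] \<and> (\<exists>y. w = x' @ y \<and> below x' y) \<Longrightarrow> length x \<le> length x'"
    using ex_has_least_nat[of "\<lambda>x. x \<noteq> [] \<and> (\<exists>y. w = x @ y \<and> below x y)" w length] assms by auto
  then obtain y where y: "w = x @ y" "below x y" by blast
  have False if "x = x1 @ x2" "x1 \<noteq> []" "x2 \<noteq> []" "below x1 x2" for x1 x2
    using min[of x1] that y by auto
  then show ?thesis using x y unfolding irreducible_word_def by blast
qed

text \<open>Of two such prefixes, the shorter one would split the longer one.\<close>

lemma irreducible_word_decomposition_unique:
  assumes eq: "x @ y = x' @ y'" and b: "below x y" "below x' y'"
    and irr: "irreducible_word x" "irreducible_word x'"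
  shows "x = x' \<and> y = y'"
proof -
  have *: "c = []" if "x = x' @ c" "below x' (c @ y)" "irreducible_word x" "irreducible_word x'" for x x' c y
    using that by (auto simp: irreducible_word_def)
  from eq obtain c where "x = x' @ c \<and> c @ y = y' \<or> x @ c = x' \<and> y = c @ y'"
    unfolding append_eq_append_conv2 by blast
  then show ?thesis
  proof (elim disjE conjE)
    assume "x = x' @ c" "c @ y = y'"
    with *[of x x' c y] b irr show ?thesis by simp
  next
    assume "x @ c = x'" "y = c @ y'"
    with *[of x' x c y'] b irr show ?thesis by simp
  qed
qed

text \<open>Take the shortest nonempty suffix \<open>s\<close> above everything before it, then the
  shortest prefix \<open>y\<close> of \<open>s\<close> that tops the rest of \<open>s\<close>. The
  two minimality conditions exclude the two ways in which \<open>y\<close> could decompose.\<close>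

lemma tot_irreducible_decomposition:
  assumes "w \<noteq> []"
  shows "\<exists>x y z. w = x @ y @ z \<and> below x (y @ z) \<and> topped y z \<and> tot_irreducible y"
proof -
  obtain s where s: "s \<noteq> [] \<and> (\<exists>x. w = x @ s \<and> below x s)"
    and mins: "\<And>s'. s' \<noteq> [] \<and> (\<exists>x. w = x @ s' \<and> below x s') \<Longrightarrow> length s \<le> length s'"
    using ex_has_least_nat[of "\<lambda>s. s \<noteq> [] \<and> (\<exists>x. w = x @ s \<and> below x s)" w length] assms by auto
  then obtain x where x: "w = x @ s" "below x s" by blast
  obtain y where y: "\<exists>z. s = y @ z \<and> topped y z"
    and miny: "\<And>y'. \<exists>z. s = y' @ z \<and> topped y' z \<Longrightarrow> length y \<le> length y'"
    using ex_has_least_nat[of "\<lambda>y. \<exists>z. s = y @ z \<and> topped y z" s length] by auto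
  then obtain z where z: "s = y @ z" "topped y z" by blast
  have ne: "y \<noteq> []" using s z by auto
  \<comment> \<open>The letters of \<open>x1\<close> are not maximal in \<open>y\<close>, so
    \<open>topped y z\<close> puts them below \<open>z\<close> as well. Then \<open>y1 @ z\<close>
    competes with \<open>s\<close>, which is the shortest suffix.\<close>
  have "x1 = []" if "y = x1 @ y1" "y1 \<noteq> []" "below x1 y1" for x1 y1
  proof -
    have "c < d" if "c \<in> set x1" "d \<in> set z" for c d
    proof -
      have "\<not> (\<forall>c'\<in>set y. c' \<le> c)"
        using that(1) \<open>y = x1 @ y1\<close> \<open>y1 \<noteq> []\<close> \<open>below x1 y1\<close>
        by (cases y1) (auto simp: below_def not_le)
      then show ?thesis using that z(2) \<open>y = x1 @ y1\<close> by (auto simp: topped_def)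
    qed
    then have "below x1 z" by (simp add: below_def)
    then have "length s \<le> length (y1 @ z)" using that x z by (intro mins) auto
    then show ?thesis using z that by simp
  qed
  \<comment> \<open>Topping composes: \<open>y1\<close> would top all of \<open>y2 @ z\<close> and
    compete with the shortest choice \<open>y\<close>.\<close>
  moreover have "y2 = []" if "y = y1 @ y2" "topped y1 y2" for y1 y2
  proof -
    have "lower y2 y1" "lower z (y1 @ y2)" using that z(2) by (auto simp: topped_def)
    then have "lower (y2 @ z) y1" by (simp add: lower_absorb)
    moreover have "(\<forall>c'\<in>set y1. c' \<le> c) \<or> (\<forall>d\<in>set (y2 @ z). c < d)" if c: "c \<in> set y1" for c
    proof (cases "\<forall>c'\<in>set y1. c' \<le> c")
      case False
      then have "\<forall>d\<in>set y2. c < d" using \<open>topped y1 y2\<close> c by (auto simp: topped_def)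
      moreover have "\<forall>d\<in>set z. c < d"
        using False z(2) c \<open>y = y1 @ y2\<close> by (auto simp: topped_def)
      ultimately show ?thesis by auto
    qed simp
    ultimately have "topped y1 (y2 @ z)" by (simp add: topped_def)
    then have "length y \<le> length y1" using z that by (intro miny) auto
    then show ?thesis using that by simp
  qed
  ultimately have "tot_irreducible y" using ne unfolding tot_irreducible_def by blast
  then show ?thesis using x z by auto
qed

lemma tot_irreducible_decomposition_unique:
  assumes eq: "x @ y @ z = x' @ y' @ z'" and b: "below x (y @ z)" "below x' (y' @ z')"
    and t: "topped y z" "topped y' z'" and irr: "tot_irreducible y" "tot_irreducible y'"
  shows "x = x' \<and> y = y' \<and> z = z'"
proof -
  \<comment> \<open>If \<open>c\<close> ends inside \<open>y\<close>, it splits \<open>y\<close>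
    into two blocks, one below the other. If \<open>c\<close> contains \<open>y\<close>, then
    \<open>y'\<close> is a part of \<open>z\<close>; it lies above \<open>y\<close> by one
    hypothesis and lower than the maximum of \<open>y\<close> by the other.\<close>
  have left: "c = []" if "x' = x @ c" "y @ z = c @ y' @ z'" "below x' (y' @ z')" "topped y z"
    "tot_irreducible y" "y' \<noteq> []" for x x' y y' z z' c :: "nat list"
  proof -
    from that(2) obtain e where "y = c @ e \<and> e @ z = y' @ z' \<or> y @ e = c \<and> z = e @ y' @ z'"
      unfolding append_eq_append_conv2[of y z] by blast
    then consider "y = c @ e" "e \<noteq> []" "y' @ z' = e @ z" | "c = y @ e" "z = e @ y' @ z'" by force
    then show ?thesis
    proof cases
      case 1
      with that(1,3) have "below c e" by simp
      with 1 that(5) show ?thesis unfolding tot_irreducible_def by blast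
    next
      case 2
      then have "below y y'" "lower y' y" using that(1,3,4) by (auto simp: topped_def)
      then have False if "d \<in> set y'" for d
        using that unfolding below_def lower_def by (meson less_asym)
      with that(6) show ?thesis by (cases y') auto
    qed
  qed
  have ne: "y \<noteq> []" "y' \<noteq> []" using irr by (auto simp: tot_irreducible_def)
  from eq obtain c where "x = x' @ c \<and> c @ y @ z = y' @ z' \<or> x @ c = x' \<and> y @ z = c @ y' @ z'"
    unfolding append_eq_append_conv2[of x] by blast
  then have x: "x = x'"
  proof (elim disjE conjE)
    assume *: "x = x' @ c" "c @ y @ z = y' @ z'"
    with left[OF *(1) *(2)[symmetric]] b t irr ne show ?thesis by simp
  next
    assume *: "x @ c = x'" "y @ z = c @ y' @ z'"
    with left[OF *(1)[symmetric] *(2)] b t irr ne show ?thesis by simp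
  qed
  \<comment> \<open>A block that tops \<open>z\<close> also tops the prefix \<open>c\<close> of
    \<open>z\<close>, so a nonempty \<open>c\<close> would decompose \<open>y'\<close>.\<close>
  have right: "c = []" if "y' = y @ c" "z = c @ z'" "topped y z" "tot_irreducible y'"
    for y y' z z' c :: "nat list"
  proof -
    have "topped y c" using that(2,3) by (auto simp: topped_def)
    then show ?thesis using that(1,4) unfolding tot_irreducible_def by blast
  qed
  from eq x have "y @ z = y' @ z'" by simp
  then obtain c where "y = y' @ c \<and> c @ z = z' \<or> y @ c = y' \<and> z = c @ z'"
    unfolding append_eq_append_conv2[of y] by blast
  then show ?thesis
  proof (elim disjE conjE)
    assume *: "y = y' @ c" "c @ z = z'"
    with right[OF *(1) *(2)[symmetric]] t irr x show ?thesis by simp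
  next
    assume *: "y @ c = y'" "z = c @ z'"
    with right[OF *(1)[symmetric] *(2)] t irr x show ?thesis by simp
  qed
qed

section \<open>Leading words of products and triple products\<close>

definition lead_prod :: "nat list \<Rightarrow> nat list \<Rightarrow> nat list \<Rightarrow> bool" where
  "lead_prod a v w \<longleftrightarrow> (\<exists>x y. w = x @ y \<and> packed w \<and> below x y \<and> pack x = a \<and> pack y = v)"

definition lead_triple :: "nat list \<Rightarrow> nat list \<Rightarrow> nat list \<Rightarrow> nat list \<Rightarrow> bool" where
  "lead_triple a p b w \<longleftrightarrow> (\<exists>x y z. w = x @ y @ z \<and> packed w \<and> y \<noteq> [] \<and>
     below x (y @ z) \<and> topped y z \<and> pack x = a \<and> pack y = p \<and> pack z = b)"

definition Irr :: "nat list set" where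
  "Irr = {w. packed w \<and> irreducible_word w}"

definition TIrr :: "nat list set" where
  "TIrr = {w. packed w \<and> tot_irreducible w}"

lemma lead_prod_in_prod_set: "lead_prod a v w \<Longrightarrow> w \<in> prod_set a v"
  unfolding lead_prod_def using lead_prod_set(1) by blast

lemma lead_prod_greatest:
  "lead_prod a v w \<Longrightarrow> w' \<in> prod_set a v \<Longrightarrow> w' \<noteq> w \<Longrightarrow> card (coinv w') < card (coinv w)"
  unfolding lead_prod_def using lead_prod_set(2) by blast

lemma lead_triple_in_triple_set: "lead_triple a p b w \<Longrightarrow> w \<in> triple_set a p b"
  unfolding lead_triple_def using lead_triple_set(1) by blast

lemma lead_triple_greatest:
  "lead_triple a p b w \<Longrightarrow> w' \<in> triple_set a p b \<Longrightarrow> w' \<noteq> w \<Longrightarrow> card (coinv w') < card (coinv w)"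
  unfolding lead_triple_def using lead_triple_set(2) by blast

text \<open>Of two different leading words, each would have fewer coinversions than the
  other.\<close>

lemma lead_prod_unique: "lead_prod a v w \<Longrightarrow> lead_prod a v w' \<Longrightarrow> w = w'"
  using lead_prod_in_prod_set lead_prod_greatest less_asym by metis

lemma lead_triple_unique: "lead_triple a p b w \<Longrightarrow> lead_triple a p b w' \<Longrightarrow> w = w'"
  using lead_triple_in_triple_set lead_triple_greatest less_asym by metis

lemma le_max_letter: "c \<in> set w \<Longrightarrow> c \<le> max_letter w"
  by (simp add: max_letter_def)

lemma lead_prod_pack:
  assumes "below x y"
  shows "lead_prod (pack x) (pack y) (pack (x @ y))"
proof -
  let ?r = "rank (set (x @ y))"
  have "pack (x @ y) = map ?r x @ map ?r y" by (simp add: pack_conv_rank)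
  then show ?thesis unfolding lead_prod_def using assms packed_pack[of "x @ y"]
    by - (rule exI[of _ "map ?r x"], rule exI[of _ "map ?r y"], simp add: rank_map_simps)
qed

lemma lead_triple_pack:
  assumes "below x (y @ z)" "topped y z" "y \<noteq> []"
  shows "lead_triple (pack x) (pack y) (pack z) (pack (x @ y @ z))"
proof -
  let ?r = "rank (set (x @ y @ z))"
  have "pack (x @ y @ z) = map ?r x @ map ?r y @ map ?r z" by (simp add: pack_conv_rank)
  then show ?thesis unfolding lead_triple_def using assms packed_pack[of "x @ y @ z"]
    by - (rule exI[of _ "map ?r x"], rule exI[of _ "map ?r y"], rule exI[of _ "map ?r z"],
      simp add: rank_map_simps)
qed

lemma ex_lead_prod:
  assumes "packed a" "packed v"
  shows "\<exists>w. lead_prod a v w"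
proof -
  \<comment> \<open>The shift moves every letter of \<open>v\<close> above all letters of
    \<open>a\<close>.\<close>
  let ?g = "\<lambda>c. Suc (max_letter a + c)"
  have "below a (map ?g v)" using le_max_letter[of _ a] by (fastforce simp: below_def)
  moreover have "pack (map ?g v) = v"
    using assms by (subst pack_map) (auto simp: pack_packed intro!: strict_mono_onI)
  ultimately show ?thesis using lead_prod_pack[of a "map ?g v"] assms by (auto simp: pack_packed)
qed

lemma ex_lead_triple:
  assumes "packed a" "packed p" "packed b" "p \<noteq> []"
  shows "\<exists>w. lead_triple a p b w"
proof -
  \<comment> \<open>The levels from bottom to top are \<open>a\<close>, the non-maximal letters of
    \<open>p\<close>, \<open>b\<close>, and the maximal letter of \<open>p\<close>. Here
    \<open>g\<close> places \<open>p\<close> and \<open>h\<close> places \<open>b\<close>; gaps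
    between levels are closed by the final packing.\<close>
  let ?A = "Suc (max_letter a)" and ?M = "max_letter p" and ?B = "Suc (max_letter b)"
  define g where "g c = (if c < ?M then ?A + c else ?A + ?B + c)" for c
  define h where "h c = ?A + ?M + c" for c
  have "?M \<in> set p" using assms max_letter_in_set by blast
  moreover have "h d < g ?M" if "d \<in> set b" for d
    using le_max_letter[OF that] by (simp add: g_def h_def)
  ultimately have "lower (map h b) (map g p)" unfolding lower_def by auto
  moreover have "(\<forall>c'\<in>set p. g c' \<le> g c) \<or> (\<forall>d\<in>set b. g c < h d)" for c
  proof (cases "c < ?M")
    case False
    have "g c' \<le> g c" if "c' \<in> set p" for c'
      using le_max_letter[OF that] False by (auto simp: g_def)
    then show ?thesis by blast
  qed (simp add: g_def h_def)
  ultimately have "topped (map g p) (map h b)" unfolding topped_def by simp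
  moreover have "below a (map g p @ map h b)"
    using le_max_letter[of _ a] by (fastforce simp: below_def g_def h_def)
  moreover have "pack (map g p) = p" "pack (map h b) = b"
    using assms by (subst pack_map; auto simp: pack_packed g_def h_def intro!: strict_mono_onI)+
  ultimately show ?thesis
    using lead_triple_pack[of a "map g p" "map h b"] assms by (auto simp: pack_packed)
qed

lemma ex_prod_decomposition:
  assumes "packed w" "w \<noteq> []"
  shows "\<exists>a v. a \<in> Irr \<and> packed v \<and> lead_prod a v w"
proof -
  obtain x y where "w = x @ y" "below x y" "irreducible_word x"
    using irreducible_word_decomposition[OF assms(2)] by blast
  then show ?thesis using assms(1)
    by - (rule exI[of _ "pack x"], rule exI[of _ "pack y"], auto simp: Irr_def lead_prod_def)
qed

lemma ex_triple_decomposition: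
  assumes "packed w" "w \<noteq> []"
  shows "\<exists>a p b. packed a \<and> p \<in> TIrr \<and> packed b \<and> lead_triple a p b w"
proof -
  obtain x y z where "w = x @ y @ z" "below x (y @ z)" "topped y z" "tot_irreducible y"
    using tot_irreducible_decomposition[OF assms(2)] by blast
  moreover from this have "y \<noteq> []" by (simp add: tot_irreducible_def)
  ultimately have "lead_triple (pack x) (pack y) (pack z) w" "pack y \<in> TIrr"
    using assms(1) unfolding lead_triple_def TIrr_def by auto
  then show ?thesis using packed_pack by blast
qed

lemma prod_decomposition_unique:
  assumes "lead_prod a v w" "lead_prod a' v' w" "a \<in> Irr" "a' \<in> Irr"
  shows "a = a' \<and> v = v'"
proof -
  obtain x y x' y' where *: "w = x @ y" "below x y" "pack x = a" "pack y = v"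
    "w = x' @ y'" "below x' y'" "pack x' = a'" "pack y' = v'"
    using assms(1,2) unfolding lead_prod_def by blast
  have "irreducible_word x" "irreducible_word x'"
    using assms(3,4) *(3,7) by (auto simp: Irr_def)
  then show ?thesis using irreducible_word_decomposition_unique[of x y x' y'] * by auto
qed

lemma triple_decomposition_unique:
  assumes "lead_triple a p b w" "lead_triple a' p' b' w" "p \<in> TIrr" "p' \<in> TIrr"
  shows "a = a' \<and> p = p' \<and> b = b'"
proof -
  obtain x y z x' y' z' where *: "w = x @ y @ z" "below x (y @ z)" "topped y z"
    "pack x = a" "pack y = p" "pack z = b"
    "w = x' @ y' @ z'" "below x' (y' @ z')" "topped y' z'" "pack x' = a'" "pack y' = p'" "pack z' = b'"
    using assms(1,2) unfolding lead_triple_def by blast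
  have "tot_irreducible y" "tot_irreducible y'"
    using assms(3,4) *(5,11) by (auto simp: TIrr_def)
  then show ?thesis using tot_irreducible_decomposition_unique[of x y z x' y' z'] * by auto
qed

lemma lead_prod_not_Irr:
  assumes "lead_prod a v w" "a \<noteq> []" "v \<noteq> []"
  shows "w \<notin> Irr"
  using assms unfolding lead_prod_def Irr_def irreducible_word_def by (auto; metis pack_Nil)

lemma lead_triple_not_TIrr:
  assumes "lead_triple a p b w" "a \<noteq> [] \<or> b \<noteq> []"
  shows "w \<notin> TIrr"
proof
  assume "w \<in> TIrr"
  obtain x y z where *: "w = x @ y @ z" "y \<noteq> []" "below x (y @ z)" "topped y z" "pack x = a" "pack z = b"
    using assms(1) unfolding lead_triple_def by blast
  have "y @ z \<noteq> []" using *(2) by simp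
  then have "x = []" using \<open>w \<in> TIrr\<close> *(1,3) unfolding TIrr_def tot_irreducible_def by blast
  moreover from this have "z = []"
    using \<open>w \<in> TIrr\<close> *(1,4) unfolding TIrr_def tot_irreducible_def by auto
  ultimately show False using * assms(2) by auto
qed

lemma lead_length:
  "lead_prod a v w \<Longrightarrow> length w = length a + length v"
  "lead_triple a p b w \<Longrightarrow> length w = length a + length p + length b"
  by (auto simp: lead_prod_def lead_triple_def)

lemma lead_prod_Nil: "lead_prod a [] w \<Longrightarrow> w = a"
  by (auto simp: lead_prod_def pack_packed)

lemma lead_triple_Nil: "lead_triple [] p [] w \<Longrightarrow> w = p"
  by (auto simp: lead_triple_def pack_packed)

section \<open>Counting packed words\<close>

text \<open>Counting through a relation that is a bijection in both directions suits decompositions,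
  which are given as relations without an explicit inverse map.\<close>

lemma card_eq_if_related:
  assumes "\<And>x. x \<in> A \<Longrightarrow> \<exists>y\<in>B. R x y" "\<And>y. y \<in> B \<Longrightarrow> \<exists>x\<in>A. R x y"
    and "\<And>x y y'. x \<in> A \<Longrightarrow> y \<in> B \<Longrightarrow> y' \<in> B \<Longrightarrow> R x y \<Longrightarrow> R x y' \<Longrightarrow> y = y'"
    and "\<And>x x' y. x \<in> A \<Longrightarrow> x' \<in> A \<Longrightarrow> y \<in> B \<Longrightarrow> R x y \<Longrightarrow> R x' y \<Longrightarrow> x = x'"
  shows "card A = card B"
proof -
  obtain f where f: "\<And>x. x \<in> A \<Longrightarrow> f x \<in> B \<and> R x (f x)" using assms(1) by metis
  have "inj_on f A" by (rule inj_onI) (metis f assms(4))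
  moreover have "f ` A = B"
  proof (intro equalityI subsetI)
    fix y assume "y \<in> f ` A"
    then show "y \<in> B" using f by blast
  next
    fix y assume y: "y \<in> B"
    then obtain x where x: "x \<in> A" "R x y" using assms(2) by blast
    then have "y = f x" using f[OF x(1)] y by (intro assms(3)[of x]) auto
    then show "y \<in> f ` A" using x(1) by simp
  qed
  ultimately show ?thesis using card_image[of f A] by simp
qed

text \<open>The generating series of a product of graded sets is the Cauchy product of their
  series.\<close>

lemma card_graded_pairs:
  fixes szB :: "'b \<Rightarrow> nat" and szD :: "'d \<Rightarrow> nat"
  assumes "\<And>k. finite {b \<in> B. szB b = k}" "\<And>k. finite {d \<in> D. szD d = k}"
  shows "card {(b, d). b \<in> B \<and> d \<in> D \<and> szB b + szD d = n}
    = (\<Sum>k\<le>n. card {b \<in> B. szB b = k} * card {d \<in> D. szD d = n - k})"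
proof -
  have "{(b, d). b \<in> B \<and> d \<in> D \<and> szB b + szD d = n}
    = (\<Union>k\<in>{..n}. {b \<in> B. szB b = k} \<times> {d \<in> D. szD d = n - k})" by auto
  also have "card \<dots> = (\<Sum>k\<le>n. card ({b \<in> B. szB b = k} \<times> {d \<in> D. szD d = n - k}))"
    using assms by (intro card_UN_disjoint) auto
  finally show ?thesis by (simp add: card_cartesian_product)
qed

text \<open>A power series with constant term 1 can be cancelled: its constant term isolates
  \<open>t n\<close> in the equation of degree \<open>n\<close>. The equations start in positive
  degree, so degree 0 is a separate hypothesis.\<close>

lemma convolution_cancel:
  fixes t t' d :: "nat \<Rightarrow> nat"
  assumes "d 0 = 1" "t 0 = t' 0"
    and "\<And>n. 0 < n \<Longrightarrow> (\<Sum>k\<le>n. t k * d (n - k)) = (\<Sum>k\<le>n. t' k * d (n - k))"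
  shows "t n = t' n"
proof (induction n rule: less_induct)
  case (less n)
  show ?case
  proof (cases n)
    case (Suc m)
    have "(\<Sum>k\<le>m. t k * d (n - k)) = (\<Sum>k\<le>m. t' k * d (n - k))"
      using less Suc by (intro sum.cong) auto
    then show ?thesis using assms(3)[of n] assms(1) Suc by simp
  qed (simp add: assms(2))
qed

lemma packed_Nil [simp]: "packed []"
  using packed_pack[of "[]"] by simp

lemma PW_0: "PW 0 = {[]}"
  by (auto simp: PW_iff)

lemma PW_eq: "PW n = {w \<in> Collect packed. length w = n}"
  by (auto simp: PW_iff)

lemma finite_graded_words: "finite {w \<in> Irr. length w = k}" "finite {w \<in> TIrr. length w = k}"
  "finite {w \<in> Collect packed. length w = k}"
proof -
  show "finite {w \<in> Collect packed. length w = k}"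
    using finite_PW[of k] by (simp add: PW_eq)
  show "finite {w \<in> Irr. length w = k}" "finite {w \<in> TIrr. length w = k}"
    by (rule finite_subset[OF _ finite_PW[of k]], simp add: PW_iff Irr_def TIrr_def subset_iff)+
qed

lemma finite_packed_pairs:
  "finite {ab \<in> Collect packed \<times> Collect packed. length (fst ab) + length (snd ab) = k}"
proof (rule finite_subset)
  show "{ab \<in> Collect packed \<times> Collect packed. length (fst ab) + length (snd ab) = k}
    \<subseteq> (\<Union>i\<le>k. PW i) \<times> (\<Union>i\<le>k. PW i)" by (auto simp: PW_iff)
qed (simp add: finite_PW)

text \<open>The equation \<open>W = 1 + I W\<close> in positive degrees, from the unique leading
  decomposition with irreducible left factor.\<close>

lemma card_PW_prod:
  assumes "0 < n"
  shows "card (PW n) = (\<Sum>k\<le>n. card {w \<in> Irr. length w = k} * card (PW (n - k)))"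
proof -
  have "card (PW n) = card {(a, v). a \<in> Irr \<and> v \<in> Collect packed \<and> length a + length v = n}"
  proof (rule card_eq_if_related[where R = "\<lambda>w (a, v). lead_prod a v w"])
    fix w assume "w \<in> PW n"
    then obtain a v where "a \<in> Irr" "packed v" "lead_prod a v w" "length w = n"
      using ex_prod_decomposition[of w] assms by (auto simp: PW_iff)
    then show "\<exists>y\<in>{(a, v). a \<in> Irr \<and> v \<in> Collect packed \<and> length a + length v = n}.
        (case y of (a, v) \<Rightarrow> lead_prod a v w)"
      using lead_length(1)[of a v w] by (intro bexI[of _ "(a, v)"]) auto
  next
    fix y assume "y \<in> {(a, v). a \<in> Irr \<and> v \<in> Collect packed \<and> length a + length v = n}"
    then obtain a v where "y = (a, v)" "packed a" "packed v" "length a + length v = n"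
      by (auto simp: Irr_def)
    moreover from this obtain w where "lead_prod a v w" using ex_lead_prod by blast
    moreover from this have "w \<in> PW (length a + length v)"
      using lead_prod_in_prod_set in_setD(1) by blast
    ultimately show "\<exists>w\<in>PW n. (case y of (a, v) \<Rightarrow> lead_prod a v w)"
      by (intro bexI[of _ w]) auto
  qed (use prod_decomposition_unique lead_prod_unique in blast)+
  then show ?thesis
    using card_graded_pairs[OF finite_graded_words(1) finite_graded_words(3), of n]
    by (simp add: PW_eq)
qed

text \<open>The equation \<open>W = 1 + P W^2\<close> in positive degrees. The middle factor
  \<open>p\<close> is put first and the pair of outer factors is one graded object, so that the
  Cauchy product can be applied twice.\<close>

lemma card_PW_triple:
  assumes "0 < n"
  shows "card (PW n) = (\<Sum>k\<le>n. card {w \<in> TIrr. length w = k} *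
    (\<Sum>i\<le>n - k. card (PW i) * card (PW (n - k - i))))"
proof -
  let ?D = "Collect packed \<times> Collect packed" and ?l = "\<lambda>ab. length (fst ab) + length (snd ab)"
  let ?B = "{(p, ab). p \<in> TIrr \<and> ab \<in> ?D \<and> length p + ?l ab = n}"
  have "card (PW n) = card ?B"
  proof (rule card_eq_if_related[where R = "\<lambda>w (p, a, b). lead_triple a p b w"])
    fix w assume w: "w \<in> PW n"
    then obtain a p b where "packed a" "p \<in> TIrr" "packed b" "lead_triple a p b w"
      using ex_triple_decomposition[of w] assms by (auto simp: PW_iff)
    with w show "\<exists>y\<in>?B. (case y of (p, a, b) \<Rightarrow> lead_triple a p b w)"
      using lead_length(2)[of a p b w] by (intro bexI[of _ "(p, a, b)"]) (auto simp: PW_iff)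
  next
    fix y assume "y \<in> ?B"
    then obtain a p b where "y = (p, a, b)" "packed a" "p \<in> TIrr" "packed b"
      "length p + (length a + length b) = n" by auto
    moreover from this obtain w where "lead_triple a p b w"
      using ex_lead_triple[of a p b] by (auto simp: TIrr_def tot_irreducible_def)
    moreover from this have "w \<in> PW (length a + length p + length b)"
      using lead_triple_in_triple_set in_setD(4) by blast
    ultimately show "\<exists>w\<in>PW n. (case y of (p, a, b) \<Rightarrow> lead_triple a p b w)"
      by (intro bexI[of _ w]) (auto simp: PW_iff)
  qed (use triple_decomposition_unique lead_triple_unique in blast)+
  also have "\<dots> = (\<Sum>k\<le>n. card {w \<in> TIrr. length w = k} * card {ab \<in> ?D. ?l ab = n - k})"
    by (rule card_graded_pairs[OF finite_graded_words(2) finite_packed_pairs])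
  finally have card: "card (PW n) = \<dots>" .
  have "card {ab \<in> ?D. ?l ab = m} = (\<Sum>i\<le>m. card (PW i) * card (PW (m - i)))" for m
  proof -
    have "{ab \<in> ?D. ?l ab = m} = {(a, b). a \<in> Collect packed \<and> b \<in> Collect packed \<and> length a + length b = m}"
      by auto
    then show ?thesis
      using card_graded_pairs[OF finite_graded_words(3) finite_graded_words(3), of m] by (simp add: PW_eq)
  qed
  then show ?thesis unfolding card by simp
qed

section \<open>Recursion for packed words by removing the maximal letter\<close>

definition labels :: "nat \<Rightarrow> nat list set" where
  "labels n = {J. valid_label J \<and> set J \<subseteq> {1..n}}"

lemma labelsD:
  assumes "J \<in> labels n"
  shows "distinct J" "sorted J" "J \<noteq> []" "length J \<le> n" "0 < length J"
proof -
  show *: "distinct J" "sorted J" "J \<noteq> []"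
    using assms by (auto simp: labels_def valid_label_def strict_sorted_iff)
  have "length J = card (set J)" using * by (simp add: distinct_card)
  also have "\<dots> \<le> card {1..n}" using assms by (intro card_mono) (auto simp: labels_def)
  finally show "length J \<le> n" by simp
  show "0 < length J" using * by simp
qed

lemma finite_labels: "finite (labels n)"
proof (rule finite_subset)
  show "labels n \<subseteq> {J. set J \<subseteq> {1..n} \<and> length J \<le> n}"
    using labelsD(4) by (auto simp: labels_def)
qed (simp add: finite_lists_length_le)

text \<open>The positions of one letter and the word that remains after deleting it can be
  prescribed freely; by \<open>insert_letter_unique\<close> they determine the word. The induction
  peels off the last position.\<close>

lemma ex_insert_letter:
  assumes "K \<subseteq> {..<n}" "length u + card K = n" "m \<notin> set u"
  shows "\<exists>w. length w = n \<and> (\<forall>i<n. w ! i = m \<longleftrightarrow> i \<in> K) \<and> filter (\<lambda>c. c \<noteq> m) w = u"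
  using assms
proof (induction n arbitrary: K u)
  case (Suc n)
  have fin: "finite K" using Suc.prems finite_subset by blast
  show ?case
  proof (cases "n \<in> K")
    case True
    have "K - {n} \<subseteq> {..<n}" using Suc.prems by auto
    moreover have "length u + card (K - {n}) = n" using Suc.prems(2) card.remove[OF fin True] by simp
    ultimately obtain w where w: "length w = n" "\<forall>i<n. w ! i = m \<longleftrightarrow> i \<in> K - {n}" "filter (\<lambda>c. c \<noteq> m) w = u"
      using Suc.IH Suc.prems(3) by blast
    then show ?thesis using True
      by (intro exI[of _ "w @ [m]"]) (auto simp: nth_append less_Suc_eq)
  next
    case False
    then have K: "K \<subseteq> {..<n}" using Suc.prems by (auto simp: less_Suc_eq)
    then have "card K \<le> n" using card_mono[of "{..<n}" K] by simp
    then obtain u' c where u: "u = u' @ [c]" using Suc.prems by (cases u rule: rev_cases) auto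
    then obtain w where w: "length w = n" "\<forall>i<n. w ! i = m \<longleftrightarrow> i \<in> K" "filter (\<lambda>c. c \<noteq> m) w = u'"
      using Suc.IH[OF K, of u'] Suc.prems(2,3) by auto
    then show ?thesis using False u Suc.prems(3)
      by (intro exI[of _ "w @ [c]"]) (auto simp: nth_append less_Suc_eq)
  qed
qed auto

lemma insert_letter_unique:
  assumes "length w = length w'" "\<forall>i<length w. w ! i = m \<longleftrightarrow> w' ! i = m"
    and "filter (\<lambda>c. c \<noteq> m) w = filter (\<lambda>c. c \<noteq> m) w'"
  shows "w = w'"
  using assms
proof (induction w w' rule: list_induct2)
  case (Cons c w c' w')
  then have "c = m \<longleftrightarrow> c' = m" "\<forall>i<length w. w ! i = m \<longleftrightarrow> w' ! i = m" by force+
  with Cons show ?case by (cases "c = m") auto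
qed simp

definition max_positions :: "nat list \<Rightarrow> nat set" where
  "max_positions w = {i. i < length w \<and> w ! i = max_letter w}"

definition remove_max :: "nat list \<Rightarrow> nat list" where
  "remove_max w = filter (\<lambda>c. c \<noteq> max_letter w) w"

lemma set_remove_max:
  assumes "packed w" "w \<noteq> []"
  shows "set (remove_max w) = {1..max_letter w - 1}"
proof -
  have "set (remove_max w) = set w - {max_letter w}" by (auto simp: remove_max_def)
  also have "\<dots> = {1..max_letter w} - {max_letter w}" using assms(1) by (simp add: packed_def)
  also have "\<dots> = {1..max_letter w - 1}" using max_letter_pos[OF assms] by auto
  finally show ?thesis .
qed

lemma max_letter_remove_max:
  assumes "packed w" "w \<noteq> []"
  shows "max_letter w = Suc (max_letter (remove_max w))"
proof -
  have "max_letter (remove_max w) = max_letter w - 1"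
    by (rule max_letter_eq[OF set_remove_max[OF assms]])
  then show ?thesis using max_letter_pos[OF assms] by simp
qed

lemma length_remove_max: "length (remove_max w) + card (max_positions w) = length w"
proof -
  have "length (filter (\<lambda>c. c = max_letter w) w) = card (max_positions w)"
    by (simp only: length_filter_conv_card max_positions_def)
  then show ?thesis
    using sum_length_filter_compl[of "\<lambda>c. c = max_letter w" w] by (simp only: remove_max_def)
qed

lemma ex_insert_max:
  assumes "packed u" "K \<subseteq> {..<n}" "length u + card K = n" "K \<noteq> {}"
  shows "\<exists>w\<in>PW n. max_positions w = K \<and> remove_max w = u"
proof -
  \<comment> \<open>The successor of the maximum makes the inserted letter the new maximum without
    leaving a gap, so the word stays packed.\<close>
  define m where "m = Suc (max_letter u)"
  have "m \<notin> set u" using le_max_letter[of m u] by (auto simp: m_def)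
  then obtain w where w: "length w = n" "\<forall>i<n. w ! i = m \<longleftrightarrow> i \<in> K" "filter (\<lambda>c. c \<noteq> m) w = u"
    using ex_insert_letter[OF assms(2,3)] by blast
  have "m \<in> set w" using w(1,2) assms(2,4) by (auto simp: in_set_conv_nth)
  moreover have "set (filter (\<lambda>c. c \<noteq> m) w) = set w - {m}" by auto
  then have "set u = set w - {m}" by (simp only: w(3))
  moreover have "set u = {1..max_letter u}" using assms(1) by (simp add: packed_def)
  ultimately have "set w = insert m {1..max_letter u}" using insert_Diff[of m "set w"] by simp
  also have "\<dots> = {1..m}" unfolding m_def by (simp add: atLeastAtMostSuc_conv)
  finally have set: "set w = {1..m}" .
  then have m: "max_letter w = m" by (rule max_letter_eq)
  have "max_positions w = K" using w(1,2) assms(2) by (auto simp: max_positions_def m)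
  moreover have "remove_max w = u" by (simp add: remove_max_def m w(3))
  ultimately show ?thesis using packedI[OF set] w(1) by (auto simp: PW_iff)
qed

lemma insert_max_unique:
  assumes "w \<in> PW n" "w' \<in> PW n" "0 < n"
    and "max_positions w = max_positions w'" "remove_max w = remove_max w'"
  shows "w = w'"
proof (rule insert_letter_unique)
  show len: "length w = length w'" using assms by (simp add: PW_iff)
  have "w \<noteq> []" "w' \<noteq> []" using assms by (auto simp: PW_iff)
  then have m: "max_letter w' = max_letter w"
    using assms by (simp add: PW_iff max_letter_remove_max)
  show "filter (\<lambda>c. c \<noteq> max_letter w) w = filter (\<lambda>c. c \<noteq> max_letter w) w'"
    using assms(5) by (simp add: remove_max_def m)
  show "\<forall>i<length w. w ! i = max_letter w \<longleftrightarrow> w' ! i = max_letter w"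
    using assms(4) len by (auto simp: max_positions_def m set_eq_iff)
qed

text \<open>A nonempty packed word amounts to the nonempty set of positions of its maximal letter
  and a packed word on the other positions. The position set is encoded as an increasing list so
  that it matches the labels of trees.\<close>

lemma card_PW_labels:
  assumes n: "0 < n"
  shows "card (PW n) = card (SIGMA J:labels n. PW (n - length J))"
proof (rule card_eq_if_related[where R = "\<lambda>w y. set (fst y) = Suc ` max_positions w \<and> snd y = remove_max w"])
  fix w assume w: "w \<in> PW n"
  let ?K = "max_positions w" and ?J = "sorted_list_of_set (Suc ` max_positions w)"
  have len: "length w = n" and pk: "packed w" and ne: "w \<noteq> []" using w n by (auto simp: PW_iff)
  have K: "?K \<noteq> {}" "finite ?K" "?K \<subseteq> {..<n}"
    using max_letter_in_set[OF pk ne] len by (auto simp: in_set_conv_nth max_positions_def)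
  have "length ?J = card ?K" by (simp add: card_image)
  then have "remove_max w \<in> PW (n - length ?J)"
    using length_remove_max[of w] len packedI[OF set_remove_max[OF pk ne]] by (simp add: PW_iff)
  moreover have "?J \<in> labels n" using K by (auto simp: labels_def valid_label_def)
  ultimately show "\<exists>y\<in>SIGMA J:labels n. PW (n - length J).
      set (fst y) = Suc ` max_positions w \<and> snd y = remove_max w"
    using K by (intro bexI[of _ "(?J, remove_max w)"]) auto
next
  fix y assume "y \<in> (SIGMA J:labels n. PW (n - length J))"
  then obtain J u where y: "y = (J, u)" and J: "J \<in> labels n" and u: "u \<in> PW (n - length J)" by auto
  \<comment> \<open>Labels count positions from 1, list indices from 0.\<close>
  let ?K = "(\<lambda>i. i - 1) ` set J"
  have K: "Suc ` ?K = set J"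
  proof -
    have "Suc (i - 1) = i" if "i \<in> set J" for i using that J by (auto simp: labels_def)
    then show ?thesis by (simp add: image_image)
  qed
  have "card ?K = length J"
    using K card_image[of Suc ?K] distinct_card[OF labelsD(1)[OF J]] by simp
  moreover have "?K \<subseteq> {..<n}" using J n by (fastforce simp: labels_def)
  moreover have "?K \<noteq> {}" using labelsD(3)[OF J] by simp
  ultimately obtain w where "w \<in> PW n" "max_positions w = ?K" "remove_max w = u"
    using ex_insert_max[of u ?K n] u labelsD(4)[OF J] by (auto simp: PW_iff)
  then show "\<exists>w\<in>PW n. set (fst y) = Suc ` max_positions w \<and> snd y = remove_max w"
    using K y by (intro bexI[of _ w]) simp_all
next
  fix w y y'
  assume "y \<in> (SIGMA J:labels n. PW (n - length J))" "y' \<in> (SIGMA J:labels n. PW (n - length J))"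
    and *: "set (fst y) = Suc ` max_positions w \<and> snd y = remove_max w"
      "set (fst y') = Suc ` max_positions w \<and> snd y' = remove_max w"
  then have J: "fst y \<in> labels n" "fst y' \<in> labels n" by auto
  have "fst y = fst y'"
    using * labelsD(1,2)[OF J(1)] labelsD(1,2)[OF J(2)] by (simp add: sorted_distinct_set_unique)
  then show "y = y'" using * by (simp add: prod_eq_iff)
next
  fix w w' y
  assume "w \<in> PW n" "w' \<in> PW n"
    and "set (fst y) = Suc ` max_positions w \<and> snd y = remove_max w"
      "set (fst y) = Suc ` max_positions w' \<and> snd y = remove_max w'"
  then show "w = w'" using insert_max_unique[OF _ _ n] by (auto simp: inj_image_eq_iff)
qed

section \<open>Counting packed forests\<close>

lemma forest_weight_simps [simp]:
  "forest_weight [] = 0" "forest_weight (t # f) = weight t + forest_weight f"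
  "forest_weight (f @ g) = forest_weight f + forest_weight g" "forest_weight (rev f) = forest_weight f"
  by (simp_all add: forest_weight_def rev_map[symmetric])

lemma forest_weight_eq_0: "\<forall>t\<in>set f. packed_tree t \<Longrightarrow> forest_weight f = 0 \<longleftrightarrow> f = []"
  using length_le_forest_weight[of f] by auto

text \<open>Greedy choice of a prefix. When a tree is appended on the right, it joins the prefix
  only if the prefix was the whole forest and the tree still fits.\<close>

lemma ex_prefix_by_weight:
  "\<exists>f s. g = f @ s \<and> forest_weight f \<le> a \<and> (s = [] \<or> a < forest_weight f + weight (hd s))"
proof (induction g rule: rev_induct)
  case (snoc t g)
  then obtain f s where f: "g = f @ s" "forest_weight f \<le> a" "s = [] \<or> a < forest_weight f + weight (hd s)"
    by blast
  show ?case
  proof (cases "s = [] \<and> forest_weight f + weight t \<le> a")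
    case True
    then show ?thesis using f by (intro exI[of _ "f @ [t]"] exI[of _ "[]"]) auto
  next
    case False
    then show ?thesis using f
      by (intro exI[of _ f] conjI exI[of _ "s @ [t]"]) (auto simp: hd_append)
  qed
qed simp

text \<open>The longer of two such prefixes would contain the tree that follows the shorter one, and
  that tree already exceeds the bound.\<close>

lemma prefix_by_weight_unique:
  assumes "f @ s = f' @ s'" "forest_weight f \<le> a" "forest_weight f' \<le> a"
    and "s = [] \<or> a < forest_weight f + weight (hd s)" "s' = [] \<or> a < forest_weight f' + weight (hd s')"
  shows "f = f'"
proof -
  have *: "us = []" if "us @ s = s'" "s' = [] \<or> a < forest_weight f' + weight (hd s')"
    "forest_weight (f' @ us) \<le> a" for us s s' f'
    using that by (cases us) auto
  from assms(1) obtain us where "f = f' @ us \<and> us @ s = s' \<or> f @ us = f' \<and> s = us @ s'"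
    unfolding append_eq_append_conv2[of f] by blast
  then show ?thesis
  proof (elim disjE conjE)
    assume us: "f = f' @ us" "us @ s = s'"
    then have "us = []" using *[OF us(2)] assms(2,5) by simp
    then show ?thesis using us by simp
  next
    assume us: "f @ us = f'" "s = us @ s'"
    have "forest_weight (f @ us) \<le> a" using assms(3) by (simp only: us(1))
    then have "us = []" by (rule *[OF us(2)[symmetric] assms(4)])
    then show ?thesis using us by simp
  qed
qed

lemma sorted_wrt_less_gap:
  assumes "sorted_wrt (<) (J :: nat list)" "i \<le> j" "j < length J"
  shows "J ! i + (j - i) \<le> J ! j"
  using assms(2,3)
proof (induction j rule: dec_induct)
  case (step k)
  then have "J ! k < J ! Suc k" using assms(1) by (simp add: sorted_wrt_nth_less)
  with step show ?case by simp
qed simp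

text \<open>
  Read as positions of letters inserted into \<open>fl @ fr @ rest\<close>, the shifted label \<open>J\<close> has \<open>hd J - 1\<close>
  old letters before it and \<open>n - last J\<close> after it. The bounds below say that \<open>fl\<close> and \<open>rest\<close> are the
  longest prefix and suffix that fit there, which determines them.
\<close>

lemma label_bounds:
  assumes "packed_tree (Node I fl fr)" "\<forall>t\<in>set rest. packed_tree t"
    and J: "J = map ((+) (forest_weight fl)) I" and n: "n = forest_weight (fl @ fr @ rest) + length I"
  shows "J \<in> labels n"
    and "forest_weight fl \<le> hd J - 1" "forest_weight rest \<le> n - last J"
    and "fr @ rest = [] \<or> hd J - 1 < forest_weight fl + weight (hd (fr @ rest))"
    and "fl @ fr = [] \<or> n - last J < forest_weight rest + weight (last (fl @ fr))"
proof -
  have I: "I \<noteq> []" "sorted_wrt (<) I" "\<forall>i\<in>set I. 0 < i"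
    using assms(1) by (auto simp: valid_label_def)
  have pos: "0 < weight t" if "t \<in> set (fl @ fr @ rest)" for t
    using that assms(1,2) packed_tree_weight_pos by auto
  have hd: "hd J = forest_weight fl + hd I" and last: "last J = forest_weight fl + last I"
    using I by (simp_all add: J hd_map last_map)
  \<comment> \<open>\<open>packed_tree_label_le\<close> bounds labels by the total weight. Emptying
    the left forest first turns this into the bound by the right-weight.\<close>
  have "right_weight (Node I [] fr) = right_weight (Node I fl fr)" by (simp add: right_weight_def)
  then have tree: "packed_tree (Node I [] fr)" using assms(1) by (cases "fr = []") simp_all
  have I_le: "i \<le> length I + forest_weight fr" if "i \<in> set I" for i
    using packed_tree_label_le[OF tree that] by (simp add: forest_weight_def)
  show "J \<in> labels n"
    using I I_le n by (fastforce simp: labels_def valid_label_def J sorted_wrt_map)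
  have "0 < hd I" using I by simp
  then show "forest_weight fl \<le> hd J - 1" using hd by simp
  show "forest_weight rest \<le> n - last J" using I_le[of "last I"] I last n by simp
  show "fr @ rest = [] \<or> hd J - 1 < forest_weight fl + weight (hd (fr @ rest))"
  proof (cases "fr = []")
    case True
    then have "I ! 0 = 1" using assms(1) I by (auto simp: valid_label_def)
    then have "hd J - 1 = forest_weight fl" using I hd by (simp add: hd_conv_nth)
    then show ?thesis using True pos by (cases rest) simp_all
  next
    case False
    then have "hd I \<le> weight (hd fr)" using assms(1) by simp
    then show ?thesis using False hd \<open>0 < hd I\<close> by simp
  qed
  show "fl @ fr = [] \<or> n - last J < forest_weight rest + weight (last (fl @ fr))"
  proof (cases "fr = []")
    case True
    then have "I ! (length I - 1) = length I" using assms(1) I by auto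
    then have "n - last J = forest_weight rest" using I last n True by (simp add: last_conv_nth)
    then show ?thesis using True pos by (cases fl rule: rev_cases) simp_all
  next
    case False
    then have "int (length I + forest_weight fr) + 1 - int (last I) \<le> int (weight (last fr))"
      using assms(1) by (simp add: right_weight_def)
    moreover have "0 < weight (last fr)" using False pos by simp
    ultimately show ?thesis using False last n by simp
  qed
qed

text \<open>Inverse of removing a root: \<open>fl\<close> and \<open>rest\<close> are cut off
  greedily from the two ends of \<open>g\<close>, what lies between becomes the right forest, and
  the label is shifted back.\<close>

lemma ex_tree_from_label:
  assumes J: "J \<in> labels n" and g: "\<forall>t\<in>set g. packed_tree t" and n: "forest_weight g + length J = n"
  shows "\<exists>I fl fr rest. packed_tree (Node I fl fr) \<and> g = fl @ fr @ rest \<and> J = map ((+) (forest_weight fl)) I"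
proof -
  have J': "sorted_wrt (<) J" "J \<noteq> []" "\<forall>i\<in>set J. 0 < i \<and> i \<le> n"
    using J by (auto simp: labels_def valid_label_def)
  let ?a = "hd J - 1" and ?b = "n - last J" and ?p = "length J"
  have gap: "J ! 0 + (?p - 1) \<le> J ! (?p - 1)" using sorted_wrt_less_gap[of J 0 "?p - 1"] J' by simp
  have hd: "hd J = J ! 0" "0 < J ! 0" and last: "last J = J ! (?p - 1)" "last J \<le> n"
    using J' by (simp_all add: hd_conv_nth last_conv_nth)
  have p: "0 < ?p" using J' by simp
  \<comment> \<open>All positions before the first and after the last label belong to
    \<open>g\<close>, so there are at most \<open>forest_weight g\<close> of them. Hence the two
    greedy pieces cannot overlap.\<close>
  have ab: "?a + ?b \<le> forest_weight g" using gap hd last n p by linarith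
  obtain fl s where fl: "g = fl @ s" "forest_weight fl \<le> ?a" "s = [] \<or> ?a < forest_weight fl + weight (hd s)"
    using ex_prefix_by_weight[of g ?a] by auto
  obtain r q where "rev g = r @ q" "forest_weight r \<le> ?b" "q = [] \<or> ?b < forest_weight r + weight (hd q)"
    using ex_prefix_by_weight[of "rev g" ?b] by auto
  then have "g = rev q @ rev r" by (metis rev_append rev_rev_ident)
  with \<open>forest_weight r \<le> ?b\<close> \<open>q = [] \<or> _\<close> obtain q rest where
    rest: "g = q @ rest" "forest_weight rest \<le> ?b" "q = [] \<or> ?b < forest_weight rest + weight (last q)"
    by (metis forest_weight_simps(4) last_rev rev_is_Nil_conv rev_rev_ident)
  have "\<exists>fr. q = fl @ fr \<and> s = fr @ rest"
  proof -
    from fl(1) rest(1) obtain e where "fl = q @ e \<and> e @ s = rest \<or> fl @ e = q \<and> s = e @ rest"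
      by (metis append_eq_append_conv2)
    then show ?thesis
    proof
      \<comment> \<open>An overlap \<open>e\<close> would be counted twice; the weight bound leaves
        no room for it, and only the empty packed forest has weight 0.\<close>
      assume e: "fl = q @ e \<and> e @ s = rest"
      then have "forest_weight g + forest_weight e \<le> ?a + ?b" using fl(1,2) rest(2) by auto
      then have "forest_weight e = 0" using ab by simp
      then have "e = []" using forest_weight_eq_0[of e] g fl(1) e by auto
      then show ?thesis using e by auto
    qed auto
  qed
  then obtain fr where fr: "q = fl @ fr" "s = fr @ rest" by blast
  define I where "I = map (\<lambda>j. j - forest_weight fl) J"
  have J_ge: "hd J \<le> j" if "j \<in> set J" for j
    using that sorted_wrt_less_gap[OF J'(1), of 0] hd by (fastforce simp: in_set_conv_nth)
  have less: "forest_weight fl < j" if "j \<in> set J" for j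
    using J_ge[OF that] fl(2) hd by linarith
  have "map (\<lambda>j. forest_weight fl + (j - forest_weight fl)) J = J"
    by (rule map_idI) (simp add: less less_imp_le)
  then have JI: "J = map ((+) (forest_weight fl)) I" by (simp add: I_def comp_def)
  have "sorted_wrt (\<lambda>i j. i - forest_weight fl < j - forest_weight fl) J"
    by (rule sorted_wrt_mono_rel[OF _ J'(1)]) (simp add: diff_less_mono less less_imp_le)
  then have "valid_label I" using J'(2) less by (simp add: valid_label_def I_def sorted_wrt_map)
  \<comment> \<open>Without a right forest all weight inequalities become equalities. So the labels
    fill an interval, which starts directly after \<open>fl\<close>.\<close>
  moreover have "I ! k = k + 1" if "fr = []" "k < length I" for k
  proof -
    have "?a = forest_weight fl" "?b = forest_weight rest"
      using that(1) fl(1,2) rest(2) ab fr by simp_all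
    then have "J ! (?p - 1) = J ! 0 + (?p - 1)" "J ! 0 = forest_weight fl + 1"
      using n fl(1) fr that(1) hd last p by simp_all
    moreover have "J ! 0 + k \<le> J ! k" "J ! k + (?p - 1 - k) \<le> J ! (?p - 1)"
      using sorted_wrt_less_gap[OF J'(1), of 0 k] sorted_wrt_less_gap[OF J'(1), of k "?p - 1"] that
      by (simp_all add: I_def)
    ultimately have "J ! k = forest_weight fl + 1 + k" using that by (simp add: I_def)
    then show ?thesis using that by (simp add: I_def)
  qed
  moreover have "1 \<le> hd I \<and> hd I \<le> weight (hd fr) \<and> 1 \<le> int (right_weight (Node I fl fr)) + 1 - int (last I)
    \<and> int (right_weight (Node I fl fr)) + 1 - int (last I) \<le> int (weight (last fr))" if "fr \<noteq> []"
  proof -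
    have "hd I = hd J - forest_weight fl" "last I = last J - forest_weight fl"
      using J'(2) by (simp_all add: I_def hd_map last_map)
    moreover have "forest_weight fl < hd J" "forest_weight fl < last J" using less J'(2) by simp_all
    moreover have "?a < forest_weight fl + weight (hd fr)" using fl(3) fr that by simp
    moreover have "?b < forest_weight rest + weight (last fr)" using rest(3) fr that by simp
    moreover have "right_weight (Node I fl fr) = ?p + forest_weight fr"
      by (simp add: right_weight_def I_def)
    moreover have "?p + forest_weight fr + forest_weight fl + forest_weight rest = n"
      using n fl(1) fr by simp
    ultimately show ?thesis using rest(2) last(2) by (intro conjI) linarith+
  qed
  ultimately have "packed_tree (Node I fl fr)" using g fl(1) fr by (cases "fr = []") simp_all
  then show ?thesis using fl(1) fr JI by blast
qed

text \<open>By \<open>label_bounds\<close> both splittings are greedy for the same forest and the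
  same bounds, so they agree at both ends.\<close>

lemma tree_from_label_unique:
  assumes "packed_tree (Node I fl fr)" "\<forall>t\<in>set rest. packed_tree t"
    and "packed_tree (Node I' fl' fr')" "\<forall>t\<in>set rest'. packed_tree t"
    and g: "fl @ fr @ rest = fl' @ fr' @ rest'"
    and J: "map ((+) (forest_weight fl)) I = map ((+) (forest_weight fl')) I'"
  shows "I = I' \<and> fl = fl' \<and> fr = fr' \<and> rest = rest'"
proof -
  have len: "length I' = length I" using arg_cong[OF J, of length] by simp
  note b = label_bounds[OF assms(1,2) refl refl]
    and b' = label_bounds[OF assms(3,4) refl refl, folded g J, unfolded len]
  have fl: "fl = fl'" by (rule prefix_by_weight_unique[OF g b(2) b'(2) b(4) b'(4)])
  \<comment> \<open>A greedy suffix is a greedy prefix of the reversed forest.\<close>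
  have "rev rest = rev rest'"
    by (rule prefix_by_weight_unique[of _ "rev (fl @ fr)" _ "rev (fl' @ fr')"])
      (use b(3,5) b'(3,5) g in \<open>auto simp: hd_rev simp flip: rev_append\<close>)
  then have "rest = rest'" by simp
  moreover have "I = I'" using J fl by (auto dest!: map_injective)
  ultimately show ?thesis using fl g by simp
qed

text \<open>Counterpart of removing the maximal letter of a word. The shift turns a label relative
  to the right forest into positions relative to the whole list
  \<open>fl @ fr @ rest\<close>.\<close>

definition root_split :: "biplane_tree list \<Rightarrow> nat list \<times> biplane_tree list \<Rightarrow> bool" where
  "root_split f y \<longleftrightarrow> (\<exists>I fl fr rest. f = Node I fl fr # rest \<and>
     y = (map ((+) (forest_weight fl)) I, fl @ fr @ rest))"

text \<open>The same recursion as for packed words in \<open>card_PW_labels\<close>, with the first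
  root in the role of the maximal letter.\<close>

lemma card_packed_forests_labels:
  assumes n: "0 < n"
  shows "card (packed_forests n) = card (SIGMA J:labels n. packed_forests (n - length J))"
proof (rule card_eq_if_related[where R = root_split])
  fix f assume f: "f \<in> packed_forests n"
  then obtain t rest where "f = t # rest" using n by (cases f) (auto simp: packed_forests_def)
  moreover obtain I fl fr where "t = Node I fl fr" by (cases t)
  ultimately have eq: "f = Node I fl fr # rest" by simp
  have pk: "packed_tree (Node I fl fr)" "\<forall>t\<in>set rest. packed_tree t"
    and w: "n = forest_weight (fl @ fr @ rest) + length I"
    using f by (auto simp: eq packed_forests_def forest_weight_def simp del: packed_tree.simps)
  let ?J = "map ((+) (forest_weight fl)) I"
  have "?J \<in> labels n" by (rule label_bounds(1)[OF pk refl w])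
  moreover have "fl @ fr @ rest \<in> packed_forests (n - length ?J)"
    using pk w by (auto simp: packed_forests_def)
  moreover have "root_split f (?J, fl @ fr @ rest)" using eq unfolding root_split_def by blast
  ultimately show "\<exists>y\<in>SIGMA J:labels n. packed_forests (n - length J). root_split f y" by blast
next
  fix y assume "y \<in> (SIGMA J:labels n. packed_forests (n - length J))"
  then obtain J g where y: "y = (J, g)" and J: "J \<in> labels n" and g: "\<forall>t\<in>set g. packed_tree t"
    "forest_weight g = n - length J" by (auto simp: packed_forests_def)
  then have w: "forest_weight g + length J = n" using labelsD(4)[OF J] by simp
  obtain I fl fr rest where t: "packed_tree (Node I fl fr)" "g = fl @ fr @ rest"
    "J = map ((+) (forest_weight fl)) I" using ex_tree_from_label[OF J g(1) w] by blast
  have "length J = length I" using t(3) by simp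
  then have "Node I fl fr # rest \<in> packed_forests n"
    using g(1) w t(1,2) by (auto simp: packed_forests_def forest_weight_def simp del: packed_tree.simps)
  moreover have "root_split (Node I fl fr # rest) y" using t(2,3) y unfolding root_split_def by blast
  ultimately show "\<exists>f\<in>packed_forests n. root_split f y" by blast
next
  fix f y y' assume "root_split f y" "root_split f y'"
  then show "y = y'" unfolding root_split_def by (elim exE conjE) simp
next
  fix f f' y assume f: "f \<in> packed_forests n" "f' \<in> packed_forests n" and "root_split f y" "root_split f' y"
  then obtain I fl fr rest I' fl' fr' rest' where *: "f = Node I fl fr # rest" "f' = Node I' fl' fr' # rest'"
    "y = (map ((+) (forest_weight fl)) I, fl @ fr @ rest)"
    "y = (map ((+) (forest_weight fl')) I', fl' @ fr' @ rest')" unfolding root_split_def by blast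
  then have eq: "fl @ fr @ rest = fl' @ fr' @ rest'"
    "map ((+) (forest_weight fl)) I = map ((+) (forest_weight fl')) I'" by simp_all
  have "packed_tree (Node I fl fr)" "\<forall>t\<in>set rest. packed_tree t"
    "packed_tree (Node I' fl' fr')" "\<forall>t\<in>set rest'. packed_tree t"
    using f unfolding *(1,2) packed_forests_def by (simp_all del: packed_tree.simps)
  then show "f = f'" using tree_from_label_unique[OF _ _ _ _ eq] *(1,2) by blast
qed

text \<open>Both counts obey the same recursion; labels are nonempty, so it refers to smaller
  degrees only.\<close>

lemma card_PW_eq_card_packed_forests: "card (PW n) = card (packed_forests n)"
proof (induction n rule: less_induct)
  case (less n)
  show ?case
  proof (cases "n = 0")
    case True
    have "packed_forests 0 = {[]}"
      using forest_weight_eq_0 by (auto simp: packed_forests_def)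
    then show ?thesis using True by (simp add: PW_0)
  next
    case False
    have "card (PW (n - length J)) = card (packed_forests (n - length J))" if "J \<in> labels n" for J
      using labelsD(5)[OF that] False by (intro less) simp
    then show ?thesis using False
      by (simp add: card_PW_labels card_packed_forests_labels finite_labels finite_PW finite_packed_forests)
  qed
qed

section \<open>Splitting off the first tree, and comparison with words\<close>

lemma card_packed_forests_Cons:
  assumes "0 < n"
  shows "card (packed_forests n) = (\<Sum>k\<le>n. card (packed_trees k) * card (packed_forests (n - k)))"
proof -
  let ?F = "{f. \<forall>t\<in>set f. packed_tree t}"
  have "card (packed_forests n)
    = card {(t, f). t \<in> Collect packed_tree \<and> f \<in> ?F \<and> weight t + forest_weight f = n}"
  proof (rule bij_betw_same_card[OF bij_betwI'])
    fix f assume "f \<in> packed_forests n"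
    then show "(hd f, tl f) \<in> {(t, f). t \<in> Collect packed_tree \<and> f \<in> ?F \<and> weight t + forest_weight f = n}"
      using assms by (cases f) (auto simp: packed_forests_def)
  next
    fix f g assume "f \<in> packed_forests n" "g \<in> packed_forests n"
    then have "f \<noteq> []" "g \<noteq> []" using assms by (auto simp: packed_forests_def)
    then show "(hd f, tl f) = (hd g, tl g) \<longleftrightarrow> f = g" by (auto intro: list.expand)
  next
    fix y assume "y \<in> {(t, f). t \<in> Collect packed_tree \<and> f \<in> ?F \<and> weight t + forest_weight f = n}"
    then show "\<exists>f\<in>packed_forests n. y = (hd f, tl f)"
      by (intro bexI[of _ "fst y # snd y"]) (auto simp: packed_forests_def)
  qed
  then show ?thesis
    using card_graded_pairs[of "Collect packed_tree" weight ?F forest_weight n]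
      finite_packed_trees finite_packed_forests
    by (simp add: packed_trees_def packed_forests_def)
qed

text \<open>The label conditions involve only the right forest, so any packed forest may be attached
  on the left.\<close>

lemma packed_tree_left_forest:
  "packed_tree (Node I fl fr) \<longleftrightarrow> packed_tree (Node I [] fr) \<and> (\<forall>t\<in>set fl. packed_tree t)"
proof -
  have "right_weight (Node I fl fr) = right_weight (Node I [] fr)" by (simp add: right_weight_def)
  then show ?thesis by (cases "fr = []") auto
qed

text \<open>The equation \<open>W = 1 + P W^2\<close> for forests: the first tree stripped of its
  left forest, that left forest, and the remaining trees are independent.\<close>

lemma card_packed_forests_root:
  assumes "0 < n"
  shows "card (packed_forests n) = (\<Sum>k\<le>n. card (packed_trees_no_left k) *
    (\<Sum>i\<le>n - k. card (packed_forests i) * card (packed_forests (n - k - i))))"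
proof -
  let ?F = "{f. \<forall>t\<in>set f. packed_tree t}" and ?w = "\<lambda>fg. forest_weight (fst fg) + forest_weight (snd fg)"
  let ?T = "{t. packed_tree t \<and> left_forest t = []}"
  let ?B = "{(t, fg). t \<in> ?T \<and> fg \<in> ?F \<times> ?F \<and> weight t + ?w fg = n}"
  let ?R = "\<lambda>f y. \<exists>I fl fr rest. f = Node I fl fr # rest \<and> y = (Node I [] fr, fl, rest)"
  have pairs: "card {fg \<in> ?F \<times> ?F. ?w fg = m} = (\<Sum>i\<le>m. card (packed_forests i) * card (packed_forests (m - i)))"
    and fin: "finite {fg \<in> ?F \<times> ?F. ?w fg = m}" for m
  proof -
    have "{fg \<in> ?F \<times> ?F. ?w fg = m} = {(f, g). f \<in> ?F \<and> g \<in> ?F \<and> forest_weight f + forest_weight g = m}"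
      by auto
    then show "card {fg \<in> ?F \<times> ?F. ?w fg = m} = (\<Sum>i\<le>m. card (packed_forests i) * card (packed_forests (m - i)))"
      using card_graded_pairs[of ?F forest_weight ?F forest_weight m] finite_packed_forests
      by (simp add: packed_forests_def)
    show "finite {fg \<in> ?F \<times> ?F. ?w fg = m}"
    proof (rule finite_subset)
      show "{fg \<in> ?F \<times> ?F. ?w fg = m} \<subseteq> (\<Union>i\<le>m. packed_forests i) \<times> (\<Union>i\<le>m. packed_forests i)"
        by (auto simp: packed_forests_def)
    qed (simp add: finite_packed_forests)
  qed
  have "card (packed_forests n) = card ?B"
  proof (rule card_eq_if_related[where R = ?R])
    fix f assume f: "f \<in> packed_forests n"
    then obtain t rest where "f = t # rest" using assms by (cases f) (auto simp: packed_forests_def)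
    moreover obtain I fl fr where "t = Node I fl fr" by (cases t)
    ultimately have eq: "f = Node I fl fr # rest" by simp
    have "packed_tree (Node I fl fr)" "\<forall>t\<in>set rest. packed_tree t"
      "n = length I + forest_weight fl + forest_weight fr + forest_weight rest"
      using f by (auto simp: eq packed_forests_def forest_weight_def simp del: packed_tree.simps)
    then have "(Node I [] fr, fl, rest) \<in> ?B"
      by (auto simp: packed_tree_left_forest[of I fl fr] forest_weight_def simp del: packed_tree.simps)
    then show "\<exists>y\<in>?B. ?R f y" using eq by blast
  next
    fix y assume "y \<in> ?B"
    then obtain t fl rest where y: "y = (t, fl, rest)" "packed_tree t" "left_forest t = []"
      "fl \<in> ?F" "rest \<in> ?F" "weight t + (forest_weight fl + forest_weight rest) = n" by auto
    then obtain I fr where t: "t = Node I [] fr" by (cases t) auto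
    have "Node I fl fr # rest \<in> packed_forests n"
      using y t by (auto simp: packed_forests_def packed_tree_left_forest[of I fl fr] forest_weight_def
        simp del: packed_tree.simps)
    then show "\<exists>f\<in>packed_forests n. ?R f y" using y t by blast
  next
    fix f y y' assume "?R f y" "?R f y'"
    then show "y = y'" by (elim exE conjE) simp
  next
    fix f f' y assume "?R f y" "?R f' y"
    then show "f = f'" by (elim exE conjE) simp
  qed
  also have "\<dots> = (\<Sum>k\<le>n. card {t \<in> ?T. weight t = k} * card {fg \<in> ?F \<times> ?F. ?w fg = n - k})"
  proof (rule card_graded_pairs[OF _ fin])
    fix k show "finite {t \<in> ?T. weight t = k}"
      by (rule finite_subset[OF _ finite_packed_trees[of k]]) (auto simp: packed_trees_def)
  qed
  finally have "card (packed_forests n) = \<dots>" .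
  moreover have "{t \<in> ?T. weight t = k} = packed_trees_no_left k" for k
    by (auto simp: packed_trees_no_left_def packed_trees_def)
  ultimately show ?thesis by (simp only: pairs)
qed

lemma packed_trees_0: "packed_trees 0 = {}" "packed_trees_no_left 0 = {}"
  using packed_tree_weight_pos by (fastforce simp: packed_trees_def packed_trees_no_left_def)+

text \<open>Words and forests satisfy \<open>W = 1 + I W\<close> with the same \<open>W\<close>,
  which has constant term 1 and can be cancelled.\<close>

lemma card_Irr: "card {w \<in> Irr. length w = n} = card (packed_trees n)"
proof (rule convolution_cancel[where t = "\<lambda>n. card {w \<in> Irr. length w = n}"
      and t' = "\<lambda>n. card (packed_trees n)" and d = "\<lambda>n. card (PW n)"])
  have "{w \<in> Irr. length w = 0} = {}" by (auto simp: Irr_def irreducible_word_def)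
  then show "card {w \<in> Irr. length w = 0} = card (packed_trees 0)" by (simp add: packed_trees_0)
next
  fix n :: nat assume n: "0 < n"
  show "(\<Sum>k\<le>n. card {w \<in> Irr. length w = k} * card (PW (n - k)))
    = (\<Sum>k\<le>n. card (packed_trees k) * card (PW (n - k)))"
    using card_PW_prod[OF n] card_packed_forests_Cons[OF n]
    by (simp add: card_PW_eq_card_packed_forests)
qed (simp add: PW_0)

text \<open>As for \<open>card_Irr\<close>, with \<open>W^2\<close> cancelled from
  \<open>W = 1 + P W^2\<close>.\<close>

lemma card_TIrr: "card {w \<in> TIrr. length w = n} = card (packed_trees_no_left n)"
proof (rule convolution_cancel[where t = "\<lambda>n. card {w \<in> TIrr. length w = n}"
      and t' = "\<lambda>n. card (packed_trees_no_left n)" and d = "\<lambda>m. \<Sum>i\<le>m. card (PW i) * card (PW (m - i))"])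
  have "{w \<in> TIrr. length w = 0} = {}" by (auto simp: TIrr_def tot_irreducible_def)
  then show "card {w \<in> TIrr. length w = 0} = card (packed_trees_no_left 0)" by (simp add: packed_trees_0)
next
  fix n :: nat assume n: "0 < n"
  show "(\<Sum>k\<le>n. card {w \<in> TIrr. length w = k} * (\<Sum>i\<le>n - k. card (PW i) * card (PW (n - k - i))))
    = (\<Sum>k\<le>n. card (packed_trees_no_left k) * (\<Sum>i\<le>n - k. card (PW i) * card (PW (n - k - i))))"
    using card_PW_triple[OF n] card_packed_forests_root[OF n]
    by (simp add: card_PW_eq_card_packed_forests)
qed (simp add: PW_0)

section \<open>Triangular systems of linear equations\<close>

text \<open>The values on \<open>S\<close> are the free parameters \<open>h\<close>; elsewhere the
  equation of \<open>w\<close> is solved for its leading coordinate. The guard on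
  \<open>\<mu>\<close> makes the recursion terminate for every \<open>B\<close> and drops the
  leading term itself.\<close>

function solve_triangular ::
  "('a \<Rightarrow> nat) \<Rightarrow> ('a \<Rightarrow> 'a set) \<Rightarrow> 'a set \<Rightarrow> ('a \<Rightarrow> 'k::field) \<Rightarrow> 'a \<Rightarrow> 'k" where
  "solve_triangular \<mu> B S h w =
     (if w \<in> S then h w else - (\<Sum>v | v \<in> B w \<and> \<mu> v < \<mu> w. solve_triangular \<mu> B S h v))"
  by pat_completeness auto
termination by (relation "measure (\<lambda>(\<mu>, B, S, h, w). \<mu> w)") auto

declare solve_triangular.simps [simp del]

text \<open>There is one equation for each \<open>w\<close> outside \<open>S\<close>, with leading
  coordinate \<open>w\<close> of coefficient 1. So the coordinates in \<open>S\<close> can be chosen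
  freely and determine the rest, over any field.\<close>

lemma dim_triangular_system:
  fixes \<mu> :: "'a \<Rightarrow> nat" and B :: "'a \<Rightarrow> 'a set"
  assumes fin: "finite X" and S: "S \<subseteq> X"
    and B: "\<And>w. w \<in> X - S \<Longrightarrow> w \<in> B w" "\<And>w. w \<in> X - S \<Longrightarrow> B w \<subseteq> X"
    "\<And>w v. w \<in> X - S \<Longrightarrow> v \<in> B w \<Longrightarrow> v \<noteq> w \<Longrightarrow> \<mu> v < \<mu> w"
  shows "vector_space.dim scale {f :: 'a \<Rightarrow>\<^sub>0 'k::field. Poly_Mapping.keys f \<subseteq> X \<and>
    (\<forall>w\<in>X - S. sum (Poly_Mapping.lookup f) (B w) = 0)} = card S"
proof -
  interpret vs: vector_space "scale :: 'k \<Rightarrow> ('a \<Rightarrow>\<^sub>0 'k) \<Rightarrow> _" by (rule vector_space_scale)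
  let ?V = "{f :: 'a \<Rightarrow>\<^sub>0 'k. Poly_Mapping.keys f \<subseteq> X \<and>
    (\<forall>w\<in>X - S. sum (Poly_Mapping.lookup f) (B w) = 0)}"
  have finB: "finite (B w)" if "w \<in> X - S" for w using finite_subset[OF B(2)[OF that] fin] .
  have split: "sum g (B w) = g w + sum g {v. v \<in> B w \<and> \<mu> v < \<mu> w}" if w: "w \<in> X - S" for g :: "'a \<Rightarrow> 'k" and w
  proof -
    have "B w - {w} = {v. v \<in> B w \<and> \<mu> v < \<mu> w}" using B(3)[OF w] by auto
    then show ?thesis using sum.remove[OF finB[OF w] B(1)[OF w], of g] by simp
  qed
  have V_eqI: "f = g" if fg: "f \<in> ?V" "g \<in> ?V"
    and eq: "\<And>s. s \<in> S \<Longrightarrow> Poly_Mapping.lookup f s = Poly_Mapping.lookup g s" for f g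
  proof (rule poly_mapping_eqI)
    fix w show "Poly_Mapping.lookup f w = Poly_Mapping.lookup g w"
    proof (induction "\<mu> w" arbitrary: w rule: less_induct)
      case less
      consider "w \<in> S" | "w \<notin> X" | "w \<in> X - S" by blast
      then show ?case
      proof cases
        case 1
        then show ?thesis by (rule eq)
      next
        case 2
        then have "w \<notin> Poly_Mapping.keys f" "w \<notin> Poly_Mapping.keys g" using fg by auto
        then show ?thesis by (simp add: in_keys_iff)
      next
        case 3
        have "Poly_Mapping.lookup f w + sum (Poly_Mapping.lookup f) {v. v \<in> B w \<and> \<mu> v < \<mu> w} = 0"
          "Poly_Mapping.lookup g w + sum (Poly_Mapping.lookup g) {v. v \<in> B w \<and> \<mu> v < \<mu> w} = 0"
          using fg 3 by (simp_all add: split[OF 3, symmetric])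
        moreover have "sum (Poly_Mapping.lookup f) {v. v \<in> B w \<and> \<mu> v < \<mu> w}
          = sum (Poly_Mapping.lookup g) {v. v \<in> B w \<and> \<mu> v < \<mu> w}"
          using less by (intro sum.cong) auto
        ultimately show ?thesis by (metis add_right_imp_eq)
      qed
    qed
  qed
  \<comment> \<open>\<open>e s\<close> is the solution that restricts to the indicator of
    \<open>s\<close> on \<open>S\<close>; these solutions form the basis.\<close>
  define e :: "'a \<Rightarrow> 'a \<Rightarrow>\<^sub>0 'k" where
    "e s = (\<Sum>w\<in>X. Poly_Mapping.single w (solve_triangular \<mu> B S (\<lambda>r. if r = s then 1 else 0) w))" for s
  have lookup_e: "Poly_Mapping.lookup (e s) w =
      (if w \<in> X then solve_triangular \<mu> B S (\<lambda>r. if r = s then 1 else 0) w else 0)" for s w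
    using fin by (simp add: e_def lookup_sum lookup_single when_def)
  have e_S: "Poly_Mapping.lookup (e s) r = (if r = s then 1 else 0)" if "r \<in> S" for s r
    using that S by (auto simp: lookup_e solve_triangular.simps)
  have e_V: "e s \<in> ?V" for s
  proof -
    have "sum (Poly_Mapping.lookup (e s)) (B w) = 0" if w: "w \<in> X - S" for w
    proof -
      have "sum (Poly_Mapping.lookup (e s)) {v. v \<in> B w \<and> \<mu> v < \<mu> w}
        = (\<Sum>v | v \<in> B w \<and> \<mu> v < \<mu> w. solve_triangular \<mu> B S (\<lambda>r. if r = s then 1 else 0) v)"
        using B(2)[OF w] by (intro sum.cong) (auto simp: lookup_e)
      then show ?thesis using w
        by (simp add: split[OF w] lookup_e[of s w] solve_triangular.simps[of \<mu> B S _ w])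
    qed
    moreover have "Poly_Mapping.keys (e s) \<subseteq> X" by (auto simp: in_keys_iff lookup_e split: if_splits)
    ultimately show ?thesis by blast
  qed
  have finS: "finite S" using S fin finite_subset by blast
  have inj: "inj_on e S"
  proof (rule inj_onI)
    fix s r assume "s \<in> S" "r \<in> S" "e s = e r"
    then have "Poly_Mapping.lookup (e s) s = Poly_Mapping.lookup (e r) s" by simp
    then show "s = r" using \<open>s \<in> S\<close> by (simp add: e_S split: if_splits)
  qed
  have lookup_comb: "Poly_Mapping.lookup (\<Sum>s\<in>S. scale (c s) (e s)) r = c r" if "r \<in> S" for c :: "'a \<Rightarrow> 'k" and r
    using that finS by (simp add: lookup_sum e_S if_distrib cong: if_cong)
  have sub: "vs.subspace ?V"
  proof (rule vs.subspaceI)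
    show "0 \<in> ?V" by simp
    show "f + g \<in> ?V" if "f \<in> ?V" "g \<in> ?V" for f g
      using that Poly_Mapping.keys_add[of f g] by (auto simp: lookup_add sum.distrib)
    show "scale c f \<in> ?V" if "f \<in> ?V" for c f
    proof -
      have "Poly_Mapping.keys (scale c f) \<subseteq> Poly_Mapping.keys f" by (auto simp: in_keys_iff)
      then show ?thesis using that by (auto simp: sum_distrib_left[symmetric])
    qed
  qed
  have "vs.independent (e ` S)"
  proof (rule vs.independent_if_scalars_zero)
    show "finite (e ` S)" using finS by simp
    fix c x assume sum: "(\<Sum>x\<in>e ` S. scale (c x) x) = 0" and "x \<in> e ` S"
    then obtain r where r: "r \<in> S" "x = e r" by blast
    have "(\<Sum>s\<in>S. scale (c (e s)) (e s)) = 0" using sum by (simp add: sum.reindex[OF inj])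
    then have "Poly_Mapping.lookup (\<Sum>s\<in>S. scale (c (e s)) (e s)) r = 0" by simp
    then show "c x = 0" using lookup_comb[OF r(1), of "\<lambda>s. c (e s)"] r(2) by simp
  qed
  moreover have "e ` S \<subseteq> ?V" using e_V by blast
  moreover have "?V \<subseteq> vs.span (e ` S)"
  proof
    fix f assume f: "f \<in> ?V"
    let ?g = "\<Sum>s\<in>S. scale (Poly_Mapping.lookup f s) (e s)"
    have "?g \<in> ?V" using e_V by (intro vs.subspace_sum[OF sub] vs.subspace_scale[OF sub])
    then have "f = ?g" using f by (intro V_eqI) (simp_all only: lookup_comb)
    moreover have "?g \<in> vs.span (e ` S)"
      by (intro vs.span_sum vs.span_scale vs.span_base) simp
    ultimately show "f \<in> vs.span (e ` S)" by simp
  qed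
  ultimately have "vs.dim ?V = card (e ` S)" by (intro vs.dim_unique) auto
  then show ?thesis using card_image[OF inj] by simp
qed

section \<open>Primitive and totally primitive elements\<close>

lemma lower_iff_max_letter:
  assumes "packed (x @ y)"
  shows "x \<noteq> [] \<Longrightarrow> lower y x \<longleftrightarrow> max_letter (x @ y) \<notin> set y"
    and "y \<noteq> [] \<Longrightarrow> lower x y \<longleftrightarrow> max_letter (x @ y) \<notin> set x"
proof -
  have le: "c \<le> max_letter (x @ y)" if "c \<in> set x \<union> set y" for c
    using that le_max_letter[of c "x @ y"] by simp
  have max: "max_letter (x @ y) \<in> set x \<union> set y" if "x @ y \<noteq> []"
    using max_letter_in_set[OF assms that] by simp
  show "lower y x \<longleftrightarrow> max_letter (x @ y) \<notin> set y" if "x \<noteq> []"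
    unfolding lower_def using le max that by (metis Un_iff append_is_Nil_conv leD le_neq_trans)
  show "lower x y \<longleftrightarrow> max_letter (x @ y) \<notin> set x" if "y \<noteq> []"
    unfolding lower_def using le max that by (metis Un_iff append_is_Nil_conv leD le_neq_trans)
qed

lemma packed_split_at:
  assumes "packed w"
  shows "(\<exists>x y. w = x @ y \<and> Q x y \<and> pack x = u \<and> pack y = v) \<longleftrightarrow>
    length u \<le> length w \<and> Q (take (length u) w) (drop (length u) w) \<and>
    pack (take (length u) w) = u \<and> pack (drop (length u) w) = v"
proof
  assume "\<exists>x y. w = x @ y \<and> Q x y \<and> pack x = u \<and> pack y = v"
  then obtain x y where "w = x @ y" "Q x y" "pack x = u" "pack y = v" by blast
  moreover from this have "length u = length x" by auto
  ultimately show "length u \<le> length w \<and> Q (take (length u) w) (drop (length u) w) \<and>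
    pack (take (length u) w) = u \<and> pack (drop (length u) w) = v" by simp
next
  assume "length u \<le> length w \<and> Q (take (length u) w) (drop (length u) w) \<and>
    pack (take (length u) w) = u \<and> pack (drop (length u) w) = v"
  then show "\<exists>x y. w = x @ y \<and> Q x y \<and> pack x = u \<and> pack y = v"
    by - (rule exI[of _ "take (length u) w"], rule exI[of _ "drop (length u) w"], simp)
qed

text \<open>Packing preserves length, so only the cut at \<open>length u\<close> can contribute.
  This makes the coefficients 0 or 1.\<close>

lemma lookup_sum_R_tensor:
  assumes "finite C" "C \<subseteq> cuts w"
  shows "Poly_Mapping.lookup (\<Sum>i\<in>C. R_tensor (pack (take i w)) (pack (drop i w))) (u, v) =
    (if length u \<in> C \<and> pack (take (length u) w) = u \<and> pack (drop (length u) w) = v then 1 else (0::'k::field))"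
proof -
  have "Poly_Mapping.lookup (\<Sum>i\<in>C. R_tensor (pack (take i w)) (pack (drop i w))) (u, v) =
    (\<Sum>i\<in>C. if pack (take i w) = u \<and> pack (drop i w) = v then 1 else (0::'k))"
    by (simp add: lookup_sum R_tensor_def lookup_single when_def)
  also have "\<dots> = (\<Sum>i\<in>C. if i = length u then
      (if pack (take (length u) w) = u \<and> pack (drop (length u) w) = v then 1 else 0) else 0)"
  proof (rule sum.cong[OF refl])
    fix i assume "i \<in> C"
    then have "i < length w" using assms(2) by (auto simp: cuts_def)
    then have "pack (take i w) = u \<Longrightarrow> i = length u" by auto
    then show "(if pack (take i w) = u \<and> pack (drop i w) = v then 1 else 0) = (if i = length u then
      (if pack (take (length u) w) = u \<and> pack (drop (length u) w) = v then 1 else 0) else (0::'k))"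
      by (cases "i = length u") auto
  qed
  finally show ?thesis using assms(1) by simp
qed

lemma finite_cuts: "finite (cuts w)"
  by (rule finite_subset[of _ "{..<length w}"]) (auto simp: cuts_def)

text \<open>The matrices of the half-coproducts are the indicators of the half-product supports.
  Both factors are nonempty because cuts are proper.\<close>

lemma lookup_\<Delta>_basis:
  assumes w: "packed w"
  shows "Poly_Mapping.lookup (\<Delta>_prec_basis w) (u, v) =
      (if u \<noteq> [] \<and> v \<noteq> [] \<and> w \<in> prec_set u v then 1 else (0::'k::field))"
    and "Poly_Mapping.lookup (\<Delta>_succ_basis w) (u, v) =
      (if u \<noteq> [] \<and> v \<noteq> [] \<and> w \<in> succ_set u v then 1 else (0::'k))"
proof -
  let ?x = "take (length u) w" and ?y = "drop (length u) w"
  have ne: "?x \<noteq> [] \<longleftrightarrow> u \<noteq> []" "?y \<noteq> [] \<longleftrightarrow> v \<noteq> []" if "pack ?x = u" "pack ?y = v"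
    using that by (metis pack_eq_Nil)+
  have cut: "length u \<in> cuts w \<longleftrightarrow> ?x \<noteq> [] \<and> ?y \<noteq> [] \<and> apart ?x ?y"
    by (auto simp: cuts_def apart_def Suc_le_eq)
  have len: "length u \<le> length w" if "pack ?x = u" using arg_cong[OF that, of length] by simp
  have w': "packed (?x @ ?y)" using w by simp
  have "w \<in> prec_set u v \<longleftrightarrow> length u \<le> length w \<and> (apart ?x ?y \<and> lower ?y ?x) \<and> pack ?x = u \<and> pack ?y = v"
    using packed_split_at[OF w, of "\<lambda>x y. apart x y \<and> lower y x" u v] w by (simp add: prec_set_def)
  then have "u \<noteq> [] \<and> v \<noteq> [] \<and> w \<in> prec_set u v \<longleftrightarrow>
      length u \<in> {i. i \<in> cuts w \<and> max_letter w \<notin> set (drop i w)} \<and> pack ?x = u \<and> pack ?y = v"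
    using cut ne len lower_iff_max_letter(1)[OF w'] unfolding append_take_drop_id mem_Collect_eq by blast
  then show "Poly_Mapping.lookup (\<Delta>_prec_basis w) (u, v) =
      (if u \<noteq> [] \<and> v \<noteq> [] \<and> w \<in> prec_set u v then 1 else (0::'k))"
    unfolding \<Delta>_prec_basis_def by (subst lookup_sum_R_tensor) (auto intro: finite_subset[OF _ finite_cuts[of w]])
  have "w \<in> succ_set u v \<longleftrightarrow> length u \<le> length w \<and> (apart ?x ?y \<and> lower ?x ?y) \<and> pack ?x = u \<and> pack ?y = v"
    using packed_split_at[OF w, of "\<lambda>x y. apart x y \<and> lower x y" u v] w by (simp add: succ_set_def)
  then have "u \<noteq> [] \<and> v \<noteq> [] \<and> w \<in> succ_set u v \<longleftrightarrow>
      length u \<in> {i. i \<in> cuts w \<and> max_letter w \<notin> set (take i w)} \<and> pack ?x = u \<and> pack ?y = v"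
    using cut ne len lower_iff_max_letter(2)[OF w'] unfolding append_take_drop_id mem_Collect_eq by blast
  then show "Poly_Mapping.lookup (\<Delta>_succ_basis w) (u, v) =
      (if u \<noteq> [] \<and> v \<noteq> [] \<and> w \<in> succ_set u v then 1 else (0::'k))"
    unfolding \<Delta>_succ_basis_def by (subst lookup_sum_R_tensor) (auto intro: finite_subset[OF _ finite_cuts[of w]])
qed

lemma sum_lookup_keys:
  assumes "finite T"
  shows "(\<Sum>w\<in>Poly_Mapping.keys f. Poly_Mapping.lookup f w * (if P \<and> w \<in> T then 1 else 0)) =
    (if P then sum (Poly_Mapping.lookup f) T else (0::'k::field))"
proof (cases P)
  case True
  have "(\<Sum>w\<in>Poly_Mapping.keys f. Poly_Mapping.lookup f w * (if P \<and> w \<in> T then 1 else 0))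
    = (\<Sum>w\<in>Poly_Mapping.keys f. if w \<in> T then Poly_Mapping.lookup f w else 0)"
    using True by (intro sum.cong) auto
  also have "\<dots> = sum (Poly_Mapping.lookup f) (Poly_Mapping.keys f \<inter> T)"
    by (simp add: sum.inter_restrict)
  also have "\<dots> = sum (Poly_Mapping.lookup f) T"
    using assms by (intro sum.mono_neutral_left) (auto simp: in_keys_iff)
  finally show ?thesis using True by simp
qed simp

text \<open>Reads \<open>f\<close> as a functional on packed words: a coefficient of its coproduct
  is its value on the corresponding product.\<close>

lemma
  assumes f: "f \<in> WQSym n"
  shows lookup_\<Delta>_prec: "Poly_Mapping.lookup (\<Delta>_prec f) (u, v) =
      (if u \<noteq> [] \<and> v \<noteq> [] then sum (Poly_Mapping.lookup f) (prec_set u v) else (0::'k::field))"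
    and lookup_\<Delta>_succ: "Poly_Mapping.lookup (\<Delta>_succ f) (u, v) =
      (if u \<noteq> [] \<and> v \<noteq> [] then sum (Poly_Mapping.lookup f) (succ_set u v) else 0)"
    and lookup_\<Delta>_tilde: "Poly_Mapping.lookup (\<Delta>_tilde f) (u, v) =
      (if u \<noteq> [] \<and> v \<noteq> [] then sum (Poly_Mapping.lookup f) (prod_set u v) else 0)"
proof -
  have packed: "packed w" if "w \<in> Poly_Mapping.keys f" for w
    using that f by (auto simp: WQSym_def PW_iff)
  have "Poly_Mapping.lookup (\<Delta>_prec f) (u, v) = (\<Sum>w\<in>Poly_Mapping.keys f. Poly_Mapping.lookup f w *
      (if (u \<noteq> [] \<and> v \<noteq> []) \<and> w \<in> prec_set u v then 1 else 0))"
    unfolding \<Delta>_prec_def linear_extension_def lookup_sum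
    by (intro sum.cong refl) (simp add: lookup_\<Delta>_basis packed)
  then show prec: "Poly_Mapping.lookup (\<Delta>_prec f) (u, v) =
      (if u \<noteq> [] \<and> v \<noteq> [] then sum (Poly_Mapping.lookup f) (prec_set u v) else 0)"
    by (simp only: sum_lookup_keys finite_sets)
  have "Poly_Mapping.lookup (\<Delta>_succ f) (u, v) = (\<Sum>w\<in>Poly_Mapping.keys f. Poly_Mapping.lookup f w *
      (if (u \<noteq> [] \<and> v \<noteq> []) \<and> w \<in> succ_set u v then 1 else 0))"
    unfolding \<Delta>_succ_def linear_extension_def lookup_sum
    by (intro sum.cong refl) (simp add: lookup_\<Delta>_basis packed)
  then show succ: "Poly_Mapping.lookup (\<Delta>_succ f) (u, v) =
      (if u \<noteq> [] \<and> v \<noteq> [] then sum (Poly_Mapping.lookup f) (succ_set u v) else 0)"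
    by (simp only: sum_lookup_keys finite_sets)
  have "sum (Poly_Mapping.lookup f) (prod_set u v) =
      sum (Poly_Mapping.lookup f) (prec_set u v) + sum (Poly_Mapping.lookup f) (succ_set u v)"
    if ne: "u \<noteq> []" "v \<noteq> []"
  proof -
    \<comment> \<open>Letter-disjoint blocks cannot share the maximal letter, so exactly one of them
      is lower than the other. Hence the product is the disjoint union of its halves.\<close>
    have max: "lower y x \<longleftrightarrow> \<not> lower x y" if "packed (x @ y)" "apart x y" "pack x = u" "pack y = v" for x y
    proof -
      have "x \<noteq> []" "y \<noteq> []" using that ne by auto
      then show ?thesis
        using lower_iff_max_letter[OF that(1)] max_letter_in_set[OF that(1)] that(2) by (auto simp: apart_def)
    qed
    have "prod_set u v = prec_set u v \<union> succ_set u v"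
      unfolding prod_set_def prec_set_def succ_set_def using max by blast
    moreover have "prec_set u v \<inter> succ_set u v = {}"
    proof -
      have False if prec: "w \<in> prec_set u v" and succ: "w \<in> succ_set u v" for w
      proof -
        obtain x y where *: "packed w" "w = x @ y" "apart x y" "lower y x" "pack x = u" "pack y = v"
          using prec unfolding prec_set_def by blast
        obtain x' y' where "w = x' @ y'" "lower x' y'" "pack x' = u"
          using succ unfolding succ_set_def by blast
        with *(2,5) have "lower x y" using length_eq_if_pack_eq[of x x'] by simp
        with max[of x y] * show False by simp
      qed
      then show ?thesis by blast
    qed
    ultimately show ?thesis by (simp add: sum.union_disjoint)
  qed
  then show "Poly_Mapping.lookup (\<Delta>_tilde f) (u, v) =
      (if u \<noteq> [] \<and> v \<noteq> [] then sum (Poly_Mapping.lookup f) (prod_set u v) else 0)"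
    by (simp add: \<Delta>_tilde_def lookup_add prec succ)
qed

lemma poly_mapping_eq_0_iff_pairs: "f = 0 \<longleftrightarrow> (\<forall>u v. Poly_Mapping.lookup f (u, v) = 0)"
  by (auto intro: poly_mapping_eqI)

lemma WQSym_subset_plus:
  assumes "0 < n"
  shows "WQSym n \<subseteq> WQSym_plus"
proof -
  have "PW n \<subseteq> (\<Union>n\<in>{1..}. PW n)" using assms by (intro UN_upper) simp
  then show ?thesis unfolding WQSym_def WQSym_plus_def by blast
qed

section \<open>Primitivity as a system of linear equations\<close>

lemma Prim_WQSym_iff:
  assumes "0 < n"
  shows "f \<in> Prim \<inter> WQSym n \<longleftrightarrow> f \<in> WQSym n \<and>
    (\<forall>u v. u \<noteq> [] \<longrightarrow> v \<noteq> [] \<longrightarrow> sum (Poly_Mapping.lookup f) (prod_set u v) = 0)"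
proof (cases "f \<in> WQSym n")
  case True
  have "\<Delta>_tilde f = 0 \<longleftrightarrow>
      (\<forall>u v. u \<noteq> [] \<longrightarrow> v \<noteq> [] \<longrightarrow> sum (Poly_Mapping.lookup f) (prod_set u v) = 0)"
    unfolding poly_mapping_eq_0_iff_pairs lookup_\<Delta>_tilde[OF True] by auto
  then show ?thesis using True WQSym_subset_plus[OF assms] unfolding Prim_def by blast
qed simp

lemma TPrim_WQSym_iff:
  assumes "0 < n"
  shows "f \<in> TPrim \<inter> WQSym n \<longleftrightarrow> f \<in> WQSym n \<and>
    (\<forall>u v. u \<noteq> [] \<longrightarrow> v \<noteq> [] \<longrightarrow> sum (Poly_Mapping.lookup f) (prec_set u v) = 0 \<and>
      sum (Poly_Mapping.lookup f) (succ_set u v) = 0)"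
proof (cases "f \<in> WQSym n")
  case True
  have "\<Delta>_prec f = 0 \<longleftrightarrow>
      (\<forall>u v. u \<noteq> [] \<longrightarrow> v \<noteq> [] \<longrightarrow> sum (Poly_Mapping.lookup f) (prec_set u v) = 0)"
    unfolding poly_mapping_eq_0_iff_pairs lookup_\<Delta>_prec[OF True] by auto
  moreover have "\<Delta>_succ f = 0 \<longleftrightarrow>
      (\<forall>u v. u \<noteq> [] \<longrightarrow> v \<noteq> [] \<longrightarrow> sum (Poly_Mapping.lookup f) (succ_set u v) = 0)"
    unfolding poly_mapping_eq_0_iff_pairs lookup_\<Delta>_succ[OF True] by auto
  ultimately show ?thesis using True WQSym_subset_plus[OF assms] unfolding TPrim_def by blast
qed simp

text \<open>
  In the identity \<open>sum_prod_prod\<close> for the leading decomposition of \<open>u\<close>, all terms on the left but the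
  one of \<open>u\<close> vanish by induction on the coinversion number.
\<close>

lemma sum_prod_set_eq_0:
  fixes g :: "nat list \<Rightarrow> 'c::comm_monoid_add"
  assumes irr: "\<And>a v. a \<in> Irr \<Longrightarrow> packed v \<Longrightarrow> v \<noteq> [] \<Longrightarrow> sum g (prod_set a v) = 0"
    and "u \<noteq> []" "v \<noteq> []"
  shows "sum g (prod_set u v) = 0"
  using assms(2)
proof (induction "card (coinv u)" arbitrary: u rule: less_induct)
  case less
  show ?case
  proof (cases "packed u \<and> packed v")
    case False
    then have "prod_set u v = {}" by (auto simp: prod_set_def)
    then show ?thesis by simp
  next
    case True
    then obtain a u' where a: "a \<in> Irr" "packed u'" "lead_prod a u' u"
      using ex_prod_decomposition[of u] less.prems by blast
    show ?thesis
    proof (cases "u' = []")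
      case True
      then have "u = a" using lead_prod_Nil a(3) by blast
      then show ?thesis using irr a(1) \<open>packed u \<and> packed v\<close> assms(3) by simp
    next
      case False
      have "sum g (prod_set d v) = 0" if "d \<in> prod_set a u' - {u}" for d
      proof (rule less.hyps)
        show "card (coinv d) < card (coinv u)" using lead_prod_greatest[OF a(3)] that by blast
        show "d \<noteq> []" using that in_setD(1)[of d a u'] False by (auto simp: PW_iff)
      qed
      then have "(\<Sum>d\<in>prod_set a u'. sum g (prod_set d v)) = sum g (prod_set u v)"
        using lead_prod_in_prod_set[OF a(3)] by (simp add: sum.remove[of _ u])
      moreover have "sum g (prod_set a e) = 0" if "e \<in> prod_set u' v" for e
        using in_setD(1)[OF that] assms(3) a(1) by (intro irr) (auto simp: PW_iff)
      ultimately show ?thesis by (simp add: sum_prod_prod)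
    qed
  qed
qed

text \<open>The same induction, now on the factor \<open>u\<close> that contains the maximal letter.
  Moving \<open>v\<close> into the triple with leading word \<open>u\<close>, by
  \<open>sum_triple_prec\<close> or \<open>sum_triple_succ\<close>, yields triples with a nonempty
  outer factor, which vanish by hypothesis.\<close>

lemma sum_prec_succ_set_eq_0:
  fixes g :: "nat list \<Rightarrow> 'c::comm_monoid_add"
  assumes tirr: "\<And>a p b. packed a \<Longrightarrow> p \<in> TIrr \<Longrightarrow> packed b \<Longrightarrow> a \<noteq> [] \<or> b \<noteq> [] \<Longrightarrow>
      sum g (triple_set a p b) = 0"
    and "u \<noteq> []" "v \<noteq> []"
  shows "sum g (prec_set u v) = 0 \<and> sum g (succ_set v u) = 0"
  using assms(2)
proof (induction "card (coinv u)" arbitrary: u rule: less_induct)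
  case less
  show ?case
  proof (cases "packed u \<and> packed v")
    case False
    then have "prec_set u v = {}" "succ_set v u = {}" by (auto simp: prec_set_def succ_set_def)
    then show ?thesis by simp
  next
    case True
    then obtain a p b where a: "packed a" "p \<in> TIrr" "packed b" "lead_triple a p b u"
      using ex_triple_decomposition[of u] less.prems by blast
    have ne: "p \<noteq> []" using a(2) by (auto simp: TIrr_def tot_irreducible_def)
    have "sum g (prec_set d v) = 0 \<and> sum g (succ_set v d) = 0" if "d \<in> triple_set a p b - {u}" for d
    proof (rule less.hyps)
      show "card (coinv d) < card (coinv u)" using lead_triple_greatest[OF a(4)] that by blast
      show "d \<noteq> []" using that in_setD(4)[of d a p b] ne by (auto simp: PW_iff)
    qed
    then have "(\<Sum>d\<in>triple_set a p b. sum g (prec_set d v)) = sum g (prec_set u v)"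
      "(\<Sum>d\<in>triple_set a p b. sum g (succ_set v d)) = sum g (succ_set v u)"
      using lead_triple_in_triple_set[OF a(4)] by (simp_all add: sum.remove[of _ u])
    moreover have "sum g (triple_set a p e) = 0" if "e \<in> prod_set b v" for e
      using in_setD(1)[OF that] assms(3) a by (intro tirr) (auto simp: PW_iff)
    moreover have "sum g (triple_set e p b) = 0" if "e \<in> prod_set v a" for e
      using in_setD(1)[OF that] assms(3) a by (intro tirr) (auto simp: PW_iff)
    ultimately show ?thesis by (simp add: sum_triple_prec sum_triple_succ)
  qed
qed

text \<open>Converse direction, from the bracketing \<open>a \<succ> (p \<prec> b)\<close>. If
  \<open>a\<close> is empty, the outer product is trivial and \<open>b\<close> is nonempty, so the
  inner product makes the sum vanish.\<close>

lemma sum_triple_set_eq_0: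
  fixes g :: "nat list \<Rightarrow> 'c::comm_monoid_add"
  assumes "\<And>u v. u \<noteq> [] \<Longrightarrow> v \<noteq> [] \<Longrightarrow> sum g (prec_set u v) = 0"
    and "\<And>u v. u \<noteq> [] \<Longrightarrow> v \<noteq> [] \<Longrightarrow> sum g (succ_set u v) = 0"
    and "p \<noteq> []" "a \<noteq> [] \<or> b \<noteq> []"
  shows "sum g (triple_set a p b) = 0"
proof (cases "a = []")
  case False
  have "sum g (succ_set a e) = 0" if "e \<in> prec_set p b" for e
    using in_setD(2)[OF that] assms(3) False by (intro assms(2)) (auto simp: PW_iff)
  then show ?thesis by (simp add: sum_triple)
next
  case True
  have "sum g (succ_set a e) = g e" if "e \<in> prec_set p b" for e
  proof -
    have "packed e" using that by (simp add: prec_set_def)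
    then have "succ_set [] e = {e}" by (auto simp: succ_set_def pack_packed)
    then show ?thesis using True by simp
  qed
  then have "sum g (triple_set a p b) = sum g (prec_set p b)" by (simp add: sum_triple)
  then show ?thesis using assms(1,3,4) True by simp
qed

section \<open>Dimensions in each degree\<close>

lemma sum_lookup_eq_0_if_length_neq:
  assumes "f \<in> WQSym n" "T \<subseteq> PW m" "m \<noteq> n"
  shows "sum (Poly_Mapping.lookup f) T = 0"
proof (rule sum.neutral, rule ballI)
  fix w assume "w \<in> T"
  then have "w \<in> PW m" using assms(2) by blast
  then have "w \<notin> PW n" using assms(3) by (simp add: PW_iff)
  then have "w \<notin> Poly_Mapping.keys f" using assms(1) unfolding WQSym_def by blast
  then show "Poly_Mapping.lookup f w = 0" by (simp add: in_keys_iff)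
qed

text \<open>The case without equations: with \<open>S = X\<close> every coordinate is free.\<close>

lemma dim_WQSym:
  "vector_space.dim scale (WQSym n :: (nat list \<Rightarrow>\<^sub>0 'k::field) set) = card (PW n)"
  using dim_triangular_system[of "PW n" "PW n" "\<lambda>w. {w}" "\<lambda>_. 0", where 'k = 'k] finite_PW
  by (simp add: WQSym_def)

lemma dim_Prim_WQSym:
  assumes n: "0 < n"
  shows "vector_space.dim scale (Prim \<inter> WQSym n :: (nat list \<Rightarrow>\<^sub>0 'k::field) set)
    = card {w \<in> Irr. length w = n}"
proof -
  let ?S = "{w \<in> Irr. length w = n}"
  \<comment> \<open>The equation attached to \<open>w\<close> comes from the product of which it is
    the leading word; the choice is determined by \<open>prod_decomposition_unique\<close>.\<close>
  define B where "B w = (SOME T. \<exists>a v. a \<in> Irr \<and> packed v \<and> lead_prod a v w \<and> T = prod_set a v)" for w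
  have B_eq: "B w = prod_set a v" if "a \<in> Irr" "packed v" "lead_prod a v w" for a v w
    unfolding B_def
  proof (rule some_equality)
    fix T assume "\<exists>a v. a \<in> Irr \<and> packed v \<and> lead_prod a v w \<and> T = prod_set a v"
    then show "T = prod_set a v" using prod_decomposition_unique that by blast
  qed (use that in blast)
  have ex: "\<exists>a v. a \<in> Irr \<and> packed v \<and> v \<noteq> [] \<and> lead_prod a v w" if w: "w \<in> PW n - ?S" for w
  proof -
    obtain a v where *: "a \<in> Irr" "packed v" "lead_prod a v w"
      using ex_prod_decomposition[of w] w n by (auto simp: PW_iff)
    moreover have "v \<noteq> []" using lead_prod_Nil * w by (auto simp: PW_iff)
    ultimately show ?thesis by blast
  qed
  have "Prim \<inter> WQSym n = {f :: nat list \<Rightarrow>\<^sub>0 'k. Poly_Mapping.keys f \<subseteq> PW n \<and>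
      (\<forall>w\<in>PW n - ?S. sum (Poly_Mapping.lookup f) (B w) = 0)}" (is "_ = ?V")
  proof (intro equalityI subsetI)
    fix f :: "nat list \<Rightarrow>\<^sub>0 'k" assume f: "f \<in> Prim \<inter> WQSym n"
    have "sum (Poly_Mapping.lookup f) (B w) = 0" if "w \<in> PW n - ?S" for w
    proof -
      obtain a v where *: "a \<in> Irr" "packed v" "v \<noteq> []" "lead_prod a v w" using ex \<open>w \<in> PW n - ?S\<close> by blast
      have "a \<noteq> []" using *(1) by (auto simp: Irr_def irreducible_word_def)
      then have "sum (Poly_Mapping.lookup f) (prod_set a v) = 0"
        using f *(3) unfolding Prim_WQSym_iff[OF n] by blast
      then show ?thesis using B_eq[OF *(1,2,4)] by simp
    qed
    then show "f \<in> ?V" using f by (simp add: WQSym_def)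
  next
    fix f :: "nat list \<Rightarrow>\<^sub>0 'k" assume f: "f \<in> ?V"
    then have fn: "f \<in> WQSym n" by (simp add: WQSym_def)
    \<comment> \<open>In degree \<open>n\<close> such an equation is the one attached to its leading
      word, which is not irreducible; in other degrees \<open>f\<close> has no coefficients. By
      \<open>sum_prod_set_eq_0\<close> these equations imply all others.\<close>
    have "sum (Poly_Mapping.lookup f) (prod_set a v) = 0" if *: "a \<in> Irr" "packed v" "v \<noteq> []" for a v
    proof (cases "length a + length v = n")
      case False
      then show ?thesis using in_setD(1) by (intro sum_lookup_eq_0_if_length_neq[OF fn]) blast+
    next
      case True
      obtain w where w: "lead_prod a v w" using ex_lead_prod * by (auto simp: Irr_def)
      have "a \<noteq> []" using *(1) by (auto simp: Irr_def irreducible_word_def)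
      then have "w \<notin> Irr" using lead_prod_not_Irr w *(3) by blast
      moreover have "w \<in> PW n" using in_setD(1)[OF lead_prod_in_prod_set[OF w]] True by simp
      ultimately have "sum (Poly_Mapping.lookup f) (B w) = 0" using f by blast
      then show ?thesis using B_eq[OF *(1,2) w] by simp
    qed
    then show "f \<in> Prim \<inter> WQSym n" unfolding Prim_WQSym_iff[OF n]
      using fn sum_prod_set_eq_0[of "Poly_Mapping.lookup f"] by blast
  qed
  moreover have "vector_space.dim scale ?V = card ?S"
  proof (rule dim_triangular_system[where \<mu> = "\<lambda>w. card (coinv w)"])
    show "?S \<subseteq> PW n" by (auto simp: Irr_def PW_iff)
    fix w assume w: "w \<in> PW n - ?S"
    then obtain a v where *: "a \<in> Irr" "packed v" "lead_prod a v w" using ex by blast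
    note B = B_eq[OF *]
    show "w \<in> B w" unfolding B by (rule lead_prod_in_prod_set[OF *(3)])
    show "B w \<subseteq> PW n" using in_setD(1) lead_length(1)[OF *(3)] w unfolding B by (auto simp: PW_iff)
    show "card (coinv w') < card (coinv w)" if "w' \<in> B w" "w' \<noteq> w" for w'
      using lead_prod_greatest[OF *(3)] that unfolding B by blast
  qed (rule finite_PW)
  ultimately show ?thesis by simp
qed

lemma dim_TPrim_WQSym:
  assumes n: "0 < n"
  shows "vector_space.dim scale (TPrim \<inter> WQSym n :: (nat list \<Rightarrow>\<^sub>0 'k::field) set)
    = card {w \<in> TIrr. length w = n}"
proof -
  let ?S = "{w \<in> TIrr. length w = n}"
  \<comment> \<open>As for \<open>Prim\<close>, with the unique triple that has \<open>w\<close> as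
    leading word.\<close>
  define B where "B w = (SOME T. \<exists>a p b. p \<in> TIrr \<and> lead_triple a p b w \<and> T = triple_set a p b)" for w
  have B_eq: "B w = triple_set a p b" if "p \<in> TIrr" "lead_triple a p b w" for a p b w
    unfolding B_def
  proof (rule some_equality)
    fix T assume "\<exists>a p b. p \<in> TIrr \<and> lead_triple a p b w \<and> T = triple_set a p b"
    then show "T = triple_set a p b" using triple_decomposition_unique that by blast
  qed (use that in blast)
  have ne: "p \<noteq> []" if "p \<in> TIrr" for p using that by (auto simp: TIrr_def tot_irreducible_def)
  have ex: "\<exists>a p b. p \<in> TIrr \<and> (a \<noteq> [] \<or> b \<noteq> []) \<and> lead_triple a p b w" if w: "w \<in> PW n - ?S" for w
  proof -
    obtain a p b where *: "p \<in> TIrr" "lead_triple a p b w"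
      using ex_triple_decomposition[of w] w n by (auto simp: PW_iff)
    moreover have "a \<noteq> [] \<or> b \<noteq> []" using lead_triple_Nil[of p w] * w by (auto simp: PW_iff)
    ultimately show ?thesis by blast
  qed
  have "TPrim \<inter> WQSym n = {f :: nat list \<Rightarrow>\<^sub>0 'k. Poly_Mapping.keys f \<subseteq> PW n \<and>
      (\<forall>w\<in>PW n - ?S. sum (Poly_Mapping.lookup f) (B w) = 0)}" (is "_ = ?V")
  proof (intro equalityI subsetI)
    fix f :: "nat list \<Rightarrow>\<^sub>0 'k" assume f: "f \<in> TPrim \<inter> WQSym n"
    have "sum (Poly_Mapping.lookup f) (B w) = 0" if "w \<in> PW n - ?S" for w
    proof -
      obtain a p b where *: "p \<in> TIrr" "a \<noteq> [] \<or> b \<noteq> []" "lead_triple a p b w"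
        using ex \<open>w \<in> PW n - ?S\<close> by blast
      have "sum (Poly_Mapping.lookup f) (triple_set a p b) = 0"
        using f ne[OF *(1)] *(2) unfolding TPrim_WQSym_iff[OF n]
        by (intro sum_triple_set_eq_0) blast+
      then show ?thesis using B_eq[OF *(1,3)] by simp
    qed
    then show "f \<in> ?V" using f by (simp add: WQSym_def)
  next
    fix f :: "nat list \<Rightarrow>\<^sub>0 'k" assume f: "f \<in> ?V"
    then have fn: "f \<in> WQSym n" by (simp add: WQSym_def)
    have "sum (Poly_Mapping.lookup f) (triple_set a p b) = 0"
      if *: "packed a" "p \<in> TIrr" "packed b" "a \<noteq> [] \<or> b \<noteq> []" for a p b
    proof (cases "length a + length p + length b = n")
      case False
      then show ?thesis using in_setD(4) by (intro sum_lookup_eq_0_if_length_neq[OF fn]) blast+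
    next
      case True
      obtain w where w: "lead_triple a p b w" using ex_lead_triple[of a p b] * ne by (auto simp: TIrr_def)
      have "w \<notin> TIrr" using lead_triple_not_TIrr w *(4) by blast
      moreover have "w \<in> PW n" using in_setD(4)[OF lead_triple_in_triple_set[OF w]] True by simp
      ultimately have "sum (Poly_Mapping.lookup f) (B w) = 0" using f by blast
      then show ?thesis using B_eq[OF *(2) w] by simp
    qed
    then show "f \<in> TPrim \<inter> WQSym n" unfolding TPrim_WQSym_iff[OF n]
      using fn sum_prec_succ_set_eq_0[of "Poly_Mapping.lookup f"] by blast
  qed
  moreover have "vector_space.dim scale ?V = card ?S"
  proof (rule dim_triangular_system[where \<mu> = "\<lambda>w. card (coinv w)"])
    show "?S \<subseteq> PW n" by (auto simp: TIrr_def PW_iff)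
    fix w assume w: "w \<in> PW n - ?S"
    then obtain a p b where *: "p \<in> TIrr" "lead_triple a p b w" using ex by blast
    note B = B_eq[OF *]
    show "w \<in> B w" unfolding B by (rule lead_triple_in_triple_set[OF *(2)])
    show "B w \<subseteq> PW n" using in_setD(4) lead_length(2)[OF *(2)] w unfolding B by (auto simp: PW_iff)
    show "card (coinv w') < card (coinv w)" if "w' \<in> B w" "w' \<noteq> w" for w'
      using lead_triple_greatest[OF *(2)] that unfolding B by blast
  qed (rule finite_PW)
  ultimately show ?thesis by simp
qed

theorem theorem2p20:
  fixes n :: nat
  shows "vector_space.dim scale (WQSym n :: (nat list \<Rightarrow>\<^sub>0 'k::field) set) = card (packed_forests n)
    \<and> vector_space.dim scale (Prim \<inter> WQSym n :: (nat list \<Rightarrow>\<^sub>0 'k) set) = card (packed_trees n)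
    \<and> vector_space.dim scale (TPrim \<inter> WQSym n :: (nat list \<Rightarrow>\<^sub>0 'k) set) = card (packed_trees_no_left n)"
proof (cases "n = 0")
  case True
  interpret vs: vector_space "scale :: 'k \<Rightarrow> (nat list \<Rightarrow>\<^sub>0 'k) \<Rightarrow> _" by (rule vector_space_scale)
  \<comment> \<open>The only packed word of length 0 is the empty one, and \<open>WQSym_plus\<close>
    excludes it.\<close>
  have "f = 0" if "f \<in> WQSym_plus" "f \<in> WQSym 0" for f :: "nat list \<Rightarrow>\<^sub>0 'k"
  proof -
    have "Poly_Mapping.keys f = {}" using that by (fastforce simp: WQSym_plus_def WQSym_def PW_iff)
    then show ?thesis by simp
  qed
  then have "Prim \<inter> WQSym 0 \<subseteq> {0 :: nat list \<Rightarrow>\<^sub>0 'k}" "TPrim \<inter> WQSym 0 \<subseteq> {0 :: nat list \<Rightarrow>\<^sub>0 'k}"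
    by (auto simp: Prim_def TPrim_def)
  then have "vs.dim (Prim \<inter> WQSym 0) = 0" "vs.dim (TPrim \<inter> WQSym 0) = 0"
    using vs.dim_le_card[of _ "{}"] by force+
  then show ?thesis
    using True by (simp add: dim_WQSym card_PW_eq_card_packed_forests packed_trees_0)
next
  case False
  then show ?thesis
    by (simp add: dim_WQSym dim_Prim_WQSym dim_TPrim_WQSym card_PW_eq_card_packed_forests card_Irr card_TIrr)
qed

end
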